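(* Let $\Bbbk$ be any field, let $R_1 = \Bbbk[\mathbb{R}_+]$, and let $\mathfrak{m}_1 \subseteq R_1$ be its graded maximal ideal. Let $F = \bigoplus_{k\in\mathbb{N}} \langle x^{\varepsilon_k}\rangle$ be the direct sum of the principal ideals of $R_1$ generated by $x^{\varepsilon_k}$, where $\{\varepsilon_k\}_{k\in\mathbb{N}}$ is a strictly decreasing sequence of positive real numbers with limit $0$. Then $\Bbbk = R_1/\mathfrak{m}_1$ has a free resolution of length $2$ over $R_1$, and $\operatorname{Ext}^2_{R_1}(\Bbbk, F) \neq 0$.
   Context: $\mathbb{R}_+$ is the additive monoid of nonnegative real numbers. $R_1 = \Bbbk[\mathbb{R}_+]$ is the monoid algebra, i.e. the ring of real-exponent polynomials in one variable $x$: finite $\Bbbk$-linear combinations of monomials $x^a$ with $a \in \mathbb{R}_+$. $\mathfrak{m}_1$ is the ideal spanned over $\Bbbk$ by all monomials $x^a$ with $a > 0$. *)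

theory Defs
  imports Complex_Main "HOL-Library.Poly_Mapping" "HOL-Algebra.Ideal" "HOL-Algebra.Module"
begin

section \<open>Modules over a commutative ring\<close>

text \<open>
  A record of type \<^typ>\<open>('a, 'm) module\<close> also has the multiplicative fields of a ring. The
  predicate \<^const>\<open>module\<close> ignores them, and they are left undefined throughout.
\<close>

definition regular_module :: "('a, 'z) ring_scheme \<Rightarrow> ('a, 'a) module" where
  "regular_module R =
    \<lparr>carrier = carrier R, mult = undefined, one = undefined,
     zero = \<zero>\<^bsub>R\<^esub>, add = (\<oplus>\<^bsub>R\<^esub>), smult = (\<otimes>\<^bsub>R\<^esub>)\<rparr>"

definition quotient_module :: "('a, 'm, 'z) module_scheme \<Rightarrow> 'm set \<Rightarrow> ('a, 'm set) module" where
  "quotient_module M N =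
    \<lparr>carrier = a_rcosets\<^bsub>M\<^esub> N, mult = undefined, one = undefined,
     zero = N, add = set_add M, smult = (\<lambda>r X. \<Union>x\<in>X. N +>\<^bsub>M\<^esub> (r \<odot>\<^bsub>M\<^esub> x))\<rparr>"

definition direct_sum :: "'i set \<Rightarrow> ('i \<Rightarrow> ('a, 'm, 'z) module_scheme) \<Rightarrow> ('a, 'i \<Rightarrow> 'm) module" where
  "direct_sum I M =
    \<lparr>carrier = {f \<in> \<Pi>\<^sub>E i\<in>I. carrier (M i). finite {i \<in> I. f i \<noteq> \<zero>\<^bsub>M i\<^esub>}},
     mult = undefined, one = undefined,
     zero = (\<lambda>i\<in>I. \<zero>\<^bsub>M i\<^esub>), add = (\<lambda>f g. \<lambda>i\<in>I. f i \<oplus>\<^bsub>M i\<^esub> g i),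
     smult = (\<lambda>r f. \<lambda>i\<in>I. r \<odot>\<^bsub>M i\<^esub> f i)\<rparr>"

text \<open>
  Linear maps are extensional: a map takes the value \<^const>\<open>undefined\<close> outside the carrier of its
  domain, so that equality of maps is equality of functions. Composites are therefore formed
  with \<^const>\<open>compose\<close>.
\<close>

definition linear_maps ::
    "('a, 'y) ring_scheme \<Rightarrow> ('a, 'm, 'z) module_scheme \<Rightarrow> ('a, 'n, 'w) module_scheme
      \<Rightarrow> ('m \<Rightarrow> 'n) set" where
  "linear_maps R M N =
    {f \<in> carrier M \<rightarrow>\<^sub>E carrier N.
      (\<forall>x\<in>carrier M. \<forall>y\<in>carrier M. f (x \<oplus>\<^bsub>M\<^esub> y) = f x \<oplus>\<^bsub>N\<^esub> f y) \<and>
      (\<forall>r\<in>carrier R. \<forall>x\<in>carrier M. f (r \<odot>\<^bsub>M\<^esub> x) = r \<odot>\<^bsub>N\<^esub> f x)}"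

definition Hom_module ::
    "('a, 'y) ring_scheme \<Rightarrow> ('a, 'm, 'z) module_scheme \<Rightarrow> ('a, 'n, 'w) module_scheme
      \<Rightarrow> ('a, 'm \<Rightarrow> 'n) module" where
  "Hom_module R M N =
    \<lparr>carrier = linear_maps R M N, mult = undefined, one = undefined,
     zero = (\<lambda>x\<in>carrier M. \<zero>\<^bsub>N\<^esub>), add = (\<lambda>f g. \<lambda>x\<in>carrier M. f x \<oplus>\<^bsub>N\<^esub> g x),
     smult = (\<lambda>r f. \<lambda>x\<in>carrier M. r \<odot>\<^bsub>N\<^esub> f x)\<rparr>"

text \<open>
  A module is free if it is isomorphic to a direct sum of copies of the ring. As a basis is a
  subset of the module, index sets in the type of the module suffice.
\<close>

definition free_module :: "('a, 'y) ring_scheme \<Rightarrow> ('a, 'm, 'z) module_scheme \<Rightarrow> bool" where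
  "free_module R M \<longleftrightarrow> module R M \<and>
    (\<exists>(B :: 'm set) \<phi>. \<phi> \<in> linear_maps R (direct_sum B (\<lambda>_. regular_module R)) M \<and>
      bij_betw \<phi> (carrier (direct_sum B (\<lambda>_. regular_module R))) (carrier M))"


section \<open>Free resolutions and Ext\<close>

text \<open>
  The exact sequence is
  \<open>\<dots> \<rightarrow> P 2 \<rightarrow> P 1 \<rightarrow> P 0 \<rightarrow> M \<rightarrow> 0\<close>, where \<open>d n\<close> maps \<open>P (Suc n)\<close> to \<open>P n\<close> and \<open>e\<close> maps
  \<open>P 0\<close> to \<open>M\<close>.
\<close>

definition free_resolution ::
    "('a, 'y) ring_scheme \<Rightarrow> ('a, 'm, 'z) module_scheme \<Rightarrow> (nat \<Rightarrow> ('a, 'p, 'w) module_scheme)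
      \<Rightarrow> (nat \<Rightarrow> 'p \<Rightarrow> 'p) \<Rightarrow> ('p \<Rightarrow> 'm) \<Rightarrow> bool" where
  "free_resolution R M P d e \<longleftrightarrow>
    (\<forall>n. free_module R (P n)) \<and>
    (\<forall>n. d n \<in> linear_maps R (P (Suc n)) (P n)) \<and>
    e \<in> linear_maps R (P 0) M \<and>
    e ` carrier (P 0) = carrier M \<and>
    a_kernel (P 0) M e = d 0 ` carrier (P 1) \<and>
    (\<forall>n. a_kernel (P (Suc n)) (P n) (d n) = d (Suc n) ` carrier (P (Suc (Suc n))))"

text \<open>
  HOL cannot quantify over all types, so one type must be fixed for the terms of a resolution.
  For a ring on \<^typ>\<open>'a\<close> and a module on \<^typ>\<open>'m\<close> take functions from \<^typ>\<open>('a + 'm) list\<close>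
  to \<^typ>\<open>'a\<close>. The type \<^typ>\<open>('a + 'm) list\<close> is infinite and at least as large as the module
  and as any free module on a subset of it. Hence every module has a free resolution by free
  modules on subsets of this type (cover by the free module on all elements, and repeat with
  the kernel), and these live in the chosen type.
\<close>

type_synonym ('a, 'm) res_term = "('a, ('a + 'm) list \<Rightarrow> 'a) module"

definition has_free_resolution_of_length ::
    "('a, 'y) ring_scheme \<Rightarrow> ('a, 'm, 'z) module_scheme \<Rightarrow> nat \<Rightarrow> bool" where
  "has_free_resolution_of_length R M l \<longleftrightarrow>
    (\<exists>(P :: nat \<Rightarrow> ('a, 'm) res_term) d e. free_resolution R M P d e \<and>
      carrier (P l) \<noteq> {\<zero>\<^bsub>P l\<^esub>} \<and> (\<forall>n>l. carrier (P n) = {\<zero>\<^bsub>P n\<^esub>}))"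

definition cocycles ::
    "('a, 'y) ring_scheme \<Rightarrow> (nat \<Rightarrow> ('a, 'p, 'w) module_scheme) \<Rightarrow> (nat \<Rightarrow> 'p \<Rightarrow> 'p)
      \<Rightarrow> ('a, 'n, 'z) module_scheme \<Rightarrow> nat \<Rightarrow> ('p \<Rightarrow> 'n) set" where
  "cocycles R P d N n =
    {f \<in> linear_maps R (P n) N.
      compose (carrier (P (Suc n))) f (d n) = \<zero>\<^bsub>Hom_module R (P (Suc n)) N\<^esub>}"

fun coboundaries ::
    "('a, 'y) ring_scheme \<Rightarrow> (nat \<Rightarrow> ('a, 'p, 'w) module_scheme) \<Rightarrow> (nat \<Rightarrow> 'p \<Rightarrow> 'p)
      \<Rightarrow> ('a, 'n, 'z) module_scheme \<Rightarrow> nat \<Rightarrow> ('p \<Rightarrow> 'n) set" where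
  "coboundaries R P d N 0 = {\<zero>\<^bsub>Hom_module R (P 0) N\<^esub>}"
| "coboundaries R P d N (Suc n) =
    (\<lambda>f. compose (carrier (P (Suc n))) f (d n)) ` linear_maps R (P n) N"

definition Hom_cohomology ::
    "('a, 'y) ring_scheme \<Rightarrow> (nat \<Rightarrow> ('a, 'p, 'w) module_scheme) \<Rightarrow> (nat \<Rightarrow> 'p \<Rightarrow> 'p)
      \<Rightarrow> ('a, 'n, 'z) module_scheme \<Rightarrow> nat \<Rightarrow> ('a, ('p \<Rightarrow> 'n) set) module" where
  "Hom_cohomology R P d N n =
    quotient_module ((Hom_module R (P n) N)\<lparr>carrier := cocycles R P d N n\<rparr>)
      (coboundaries R P d N n)"

text \<open>
  \<open>Ext\<^sup>n(M, N)\<close> is the \<open>n\<close>-th cohomology of \<open>Hom(P, N)\<close> for a chosen free resolution \<open>P\<close> of \<open>M\<close>;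
  up to isomorphism it does not depend on the choice.
\<close>

definition Ext ::
    "('a, 'y) ring_scheme \<Rightarrow> nat \<Rightarrow> ('a, 'm, 'z) module_scheme \<Rightarrow> ('a, 'n, 'w) module_scheme
      \<Rightarrow> ('a, ((('a + 'm) list \<Rightarrow> 'a) \<Rightarrow> 'n) set) module" where
  "Ext R n M N =
    (let (P, d) = (SOME (P :: nat \<Rightarrow> ('a, 'm) res_term, d). \<exists>e. free_resolution R M P d e)
     in Hom_cohomology R P d N n)"


section \<open>Real-exponent polynomials\<close>

text \<open>
  A finitely supported function \<^typ>\<open>real \<Rightarrow>\<^sub>0 'k\<close> is a finite linear combination of monomials
  with real exponents, and \<^const>\<open>Poly_Mapping.keys\<close> is the set of exponents that occur.
  Multiplication in this type is convolution. Thus \<open>m1\<close> below is the span over \<open>k\<close> of the monomials with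
  positive exponent.
\<close>

definition R1 :: "(real \<Rightarrow>\<^sub>0 'k::field) ring" where
  "R1 = \<lparr>carrier = {p. Poly_Mapping.keys p \<subseteq> {0..}}, mult = (*), one = 1, zero = 0, add = (+)\<rparr>"

definition xpow :: "real \<Rightarrow> (real \<Rightarrow>\<^sub>0 'k::field)" where
  "xpow a = Poly_Mapping.single a 1"

definition m1 :: "(real \<Rightarrow>\<^sub>0 'k::field) set" where
  "m1 = {p. Poly_Mapping.keys p \<subseteq> {0<..}}"

definition residue_field :: "(real \<Rightarrow>\<^sub>0 'k::field, (real \<Rightarrow>\<^sub>0 'k) set) module" where
  "residue_field = quotient_module (regular_module R1) m1"

definition F_module :: "(nat \<Rightarrow> real) \<Rightarrow> (real \<Rightarrow>\<^sub>0 'k::field, nat \<Rightarrow> (real \<Rightarrow>\<^sub>0 'k)) module" where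
  "F_module \<epsilon> =
    direct_sum UNIV (\<lambda>k. (regular_module R1)\<lparr>carrier := PIdl\<^bsub>R1\<^esub> (xpow (\<epsilon> k))\<rparr>)"

end

theory Submission
  imports Defs
begin

text \<open>
  The resolution has one generator \<open>y\<^sub>n\<close> in degree one for each \<open>x\<^bsup>\<epsilon> n\<^esup>\<close>, and its
  relations compare consecutive generators. Now let \<open>P\<close> be any free resolution of \<open>k\<close>, and lift
  \<open>e : P 0 \<rightarrow> k\<close> to \<open>\<phi> : P 0 \<rightarrow> R1\<close>. As \<open>\<phi> \<circ> d 0\<close> has values in \<open>m1\<close>, truncation on a basis of
  \<open>P 1\<close> gives a map \<open>v\<close> from \<open>P 1\<close> to the product of the ideals \<open>\<langle>x\<^bsup>\<epsilon> k\<^esup>\<rangle>\<close> whose \<open>k\<close>-th component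
  agrees with \<open>\<phi> \<circ> d 0\<close> at a given element for all large \<open>k\<close>. Hence \<open>u = v \<circ> d 1\<close> is a cocycle with
  values in the direct sum \<open>F\<close>. If \<open>u = g \<circ> d 1\<close>, then \<open>w = v - g\<close> vanishes on the kernel of \<open>d 0\<close>.
  Choose \<open>p\<close> with \<open>e p = 1\<close> and \<open>a n\<close> with \<open>d 0 (a n) = x\<^bsup>\<epsilon> n\<^esup> p\<close>. Then
  \<open>w (a 0) = x\<^bsup>\<epsilon> 0 - \<epsilon> m\<^esup> w (a m)\<close> for all \<open>m\<close>, which forces the coefficient of \<open>x\<^bsup>\<epsilon> 0\<^esup>\<close> in every
  component of \<open>w (a 0)\<close> to be \<open>0\<close>. For large \<open>k\<close>, however, that component is \<open>x\<^bsup>\<epsilon> 0\<^esup> \<phi> p\<close>,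
  where the coefficient is \<open>1\<close>.
\<close>

section \<open>The ring of real-exponent polynomials\<close>

abbreviation const_coeff :: "(real \<Rightarrow>\<^sub>0 'k::field) \<Rightarrow> 'k" where
  "const_coeff p \<equiv> Poly_Mapping.lookup p 0"

lemma R1_simps [simp]:
  "carrier R1 = {p. Poly_Mapping.keys p \<subseteq> {0..}}"
  "x \<otimes>\<^bsub>R1\<^esub> y = x * y" "\<one>\<^bsub>R1\<^esub> = 1" "\<zero>\<^bsub>R1\<^esub> = 0" "x \<oplus>\<^bsub>R1\<^esub> y = x + y"
  by (simp_all add: R1_def)

lemma regular_R1_simps [simp]:
  "carrier (regular_module R1) = {p. Poly_Mapping.keys p \<subseteq> {0..}}"
  "\<zero>\<^bsub>regular_module R1\<^esub> = 0" "x \<oplus>\<^bsub>regular_module R1\<^esub> y = x + y"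
  "x \<odot>\<^bsub>regular_module R1\<^esub> y = x * y"
  by (simp_all add: regular_module_def R1_def)

lemma keys_mult_atLeast:
  fixes p q :: "real \<Rightarrow>\<^sub>0 'k::field"
  assumes "Poly_Mapping.keys p \<subseteq> {a..}" "Poly_Mapping.keys q \<subseteq> {b..}"
  shows "Poly_Mapping.keys (p * q) \<subseteq> {a + b..}"
  using keys_mult[of p q] assms by fastforce

lemma keys_mult_nonneg:
  fixes p q :: "real \<Rightarrow>\<^sub>0 'k::field"
  assumes "Poly_Mapping.keys p \<subseteq> {0..}" "Poly_Mapping.keys q \<subseteq> {a..}"
  shows "Poly_Mapping.keys (p * q) \<subseteq> {a..}"
  using keys_mult_atLeast[OF assms] by simp

lemma keys_add_subset:
  "Poly_Mapping.keys p \<subseteq> A \<Longrightarrow> Poly_Mapping.keys q \<subseteq> A \<Longrightarrow> Poly_Mapping.keys (p + q) \<subseteq> A"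
  using keys_add[of p q] by blast

lemma keys_sum_subset:
  "(\<And>i. i \<in> S \<Longrightarrow> Poly_Mapping.keys (f i) \<subseteq> A) \<Longrightarrow> Poly_Mapping.keys (sum f S) \<subseteq> A"
  using keys_sum[of f S] by blast

lemma keys_xpow [simp]: "Poly_Mapping.keys (xpow a) = {a}"
  by (simp add: xpow_def)

lemma xpow_mult: "xpow a * xpow b = xpow (a + b)"
  by (simp add: xpow_def mult_single)

lemma xpow_0 [simp]: "xpow 0 = 1"
  by (simp add: xpow_def)

text \<open>The ambient type allows negative exponents, so \<open>xpow a\<close> has the inverse
  \<open>xpow (- a)\<close> there; the exponent bound says exactly that the quotient falls back into
  \<open>R1\<close>.\<close>

lemma factor_xpow:
  assumes "Poly_Mapping.keys p \<subseteq> {a..}"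
  obtains q where "Poly_Mapping.keys q \<subseteq> {0..}" "p = q * xpow a"
proof
  show "Poly_Mapping.keys (xpow (- a) * p) \<subseteq> {0..}"
    using keys_mult_atLeast[of "xpow (- a)" "- a" p a] assms by simp
  show "p = xpow (- a) * p * xpow a"
    using xpow_mult[of a "- a"] by (metis add.right_inverse mult.commute mult.left_commute mult_1 xpow_0)
qed

text \<open>Ideal membership becomes a lower bound on exponents, which is how the summands of
  \<open>F_module\<close> are handled from here on. \<open>factor_xpow\<close> supplies the harder
  inclusion.\<close>

lemma PIdl_xpow: "PIdl\<^bsub>R1\<^esub> (xpow a) = {p. Poly_Mapping.keys p \<subseteq> {a..}}"
proof (intro equalityI subsetI)
  fix p :: "real \<Rightarrow>\<^sub>0 'a" assume "p \<in> PIdl\<^bsub>R1\<^esub> (xpow a)"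
  then obtain x where "Poly_Mapping.keys x \<subseteq> {0..}" "p = x * xpow a"
    by (auto simp: cgenideal_def)
  then show "p \<in> {p. Poly_Mapping.keys p \<subseteq> {a..}}"
    using keys_mult_nonneg[of x "xpow a" a] by simp
next
  fix p :: "real \<Rightarrow>\<^sub>0 'a" assume "p \<in> {p. Poly_Mapping.keys p \<subseteq> {a..}}"
  then obtain q where "Poly_Mapping.keys q \<subseteq> {0..}" "p = q * xpow a"
    using factor_xpow[of p a] by blast
  then show "p \<in> PIdl\<^bsub>R1\<^esub> (xpow a)"
    unfolding cgenideal_def by auto
qed

text \<open>With nonnegative exponents, a product of two monomials has exponent 0 only when both
  factors do. So only the two constant terms contribute.\<close>

lemma const_coeff_mult:
  assumes p: "Poly_Mapping.keys p \<subseteq> {0..}" and q: "Poly_Mapping.keys q \<subseteq> {0..}"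
  shows "const_coeff (p * q) = const_coeff p * const_coeff q"
proof -
  have split: "\<exists>r'. r = Poly_Mapping.single 0 (const_coeff r) + r' \<and> Poly_Mapping.keys r' \<subseteq> {0<..}"
    if r: "Poly_Mapping.keys r \<subseteq> {0..}" for r :: "real \<Rightarrow>\<^sub>0 'a"
  proof (intro exI conjI)
    show "Poly_Mapping.keys (r - Poly_Mapping.single 0 (const_coeff r)) \<subseteq> {0<..}"
      using r by (fastforce simp: in_keys_iff lookup_minus lookup_single when_def
          split: if_splits intro: less_le[THEN iffD2])
  qed simp
  obtain p' where p': "p = Poly_Mapping.single 0 (const_coeff p) + p'" "Poly_Mapping.keys p' \<subseteq> {0<..}"
    using split[OF p] by blast
  obtain q' where q': "q = Poly_Mapping.single 0 (const_coeff q) + q'" "Poly_Mapping.keys q' \<subseteq> {0<..}"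
    using split[OF q] by blast
  let ?a = "Poly_Mapping.single (0::real) (const_coeff p)"
  let ?b = "Poly_Mapping.single (0::real) (const_coeff q)"
  have "p * q = ?a * q + p' * q"
    using p'(1) by (metis distrib_right)
  moreover have "?a * q = ?a * ?b + ?a * q'"
    using q'(1) by (metis distrib_left)
  ultimately have "p * q = ?a * ?b + (?a * q' + p' * q)"
    by simp
  moreover have "0 \<notin> Poly_Mapping.keys (?a * q')"
    using keys_mult[of ?a q'] q'(2) by (fastforce split: if_splits)
  moreover have "0 \<notin> Poly_Mapping.keys (p' * q)"
    using keys_mult[of p' q] p'(2) q by fastforce
  ultimately show ?thesis
    by (simp add: lookup_add mult_single in_keys_iff)
qed

text \<open>Shifting by \<open>a\<close> moves only the constant term to exponent \<open>a\<close>.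
  This coefficient yields the final contradiction in \<open>obstruction_cocycle\<close>.\<close>

lemma lookup_xpow_mult:
  assumes "Poly_Mapping.keys p \<subseteq> {0..}"
  shows "Poly_Mapping.lookup (xpow a * p) a = const_coeff p"
proof -
  let ?r = "p - Poly_Mapping.single 0 (const_coeff p)"
  have "a \<notin> Poly_Mapping.keys (xpow a * ?r)"
    using keys_mult[of "xpow a" ?r] by (fastforce simp: in_keys_iff lookup_minus lookup_single)
  moreover have "xpow a * p = xpow a * ?r + Poly_Mapping.single a (const_coeff p)"
    by (simp add: algebra_simps xpow_def mult_single)
  ultimately show ?thesis
    by (simp add: lookup_add in_keys_iff)
qed

lemma cring_R1: "cring (R1 :: (real \<Rightarrow>\<^sub>0 'k::field) ring)"
proof (rule cringI)
  show "abelian_group (R1 :: (real \<Rightarrow>\<^sub>0 'k) ring)"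
    by (rule abelian_groupI) (auto simp: keys_add_subset algebra_simps, metis add.right_inverse keys_minus)
  show "comm_monoid (R1 :: (real \<Rightarrow>\<^sub>0 'k) ring)"
    by (rule comm_monoidI) (simp_all add: keys_mult_nonneg algebra_simps)
qed (simp add: algebra_simps)


section \<open>Linear maps and direct sums\<close>

lemma linear_maps_closed: "f \<in> linear_maps R M N \<Longrightarrow> x \<in> carrier M \<Longrightarrow> f x \<in> carrier N"
  by (auto simp: linear_maps_def)

lemma linear_maps_add:
  "f \<in> linear_maps R M N \<Longrightarrow> x \<in> carrier M \<Longrightarrow> y \<in> carrier M \<Longrightarrow> f (x \<oplus>\<^bsub>M\<^esub> y) = f x \<oplus>\<^bsub>N\<^esub> f y"
  by (auto simp: linear_maps_def)

lemma linear_maps_smult: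
  "f \<in> linear_maps R M N \<Longrightarrow> r \<in> carrier R \<Longrightarrow> x \<in> carrier M \<Longrightarrow> f (r \<odot>\<^bsub>M\<^esub> x) = r \<odot>\<^bsub>N\<^esub> f x"
  by (auto simp: linear_maps_def)

text \<open>Elements of \<open>linear_maps\<close> are extensional, so the inverse has to be
  restricted to the carrier. Linearity is checked after applying \<open>f\<close>.\<close>

lemma inv_into_linear:
  assumes M: "module R M" and f: "f \<in> linear_maps R M N" and bij: "bij_betw f (carrier M) (carrier N)"
  shows "(\<lambda>y\<in>carrier N. inv_into (carrier M) f y) \<in> linear_maps R N M"
proof -
  interpret module R M by fact
  let ?g = "inv_into (carrier M) f"
  have g: "?g y \<in> carrier M" "f (?g y) = y" if "y \<in> carrier N" for y
    using that bij by (metis bij_betw_imp_surj_on inv_into_into, metis bij_betw_inv_into_right)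
  have eq: "?g y = x" if "x \<in> carrier M" "f x = y" for x y
    using that bij by (metis bij_betw_inv_into_left)
  \<comment> \<open>Closure of the carrier of \<open>N\<close> comes together with additivity, by
    transport from \<open>M\<close> along \<open>f\<close>; the restricted inverse is evaluated at
    these elements.\<close>
  have "?g (x \<oplus>\<^bsub>N\<^esub> y) = ?g x \<oplus>\<^bsub>M\<^esub> ?g y" "x \<oplus>\<^bsub>N\<^esub> y \<in> carrier N"
    if "x \<in> carrier N" "y \<in> carrier N" for x y
    using that g linear_maps_add[OF f, of "?g x" "?g y"] linear_maps_closed[OF f, of "?g x \<oplus>\<^bsub>M\<^esub> ?g y"]
    by (auto intro: eq)
  moreover have "?g (r \<odot>\<^bsub>N\<^esub> x) = r \<odot>\<^bsub>M\<^esub> ?g x" "r \<odot>\<^bsub>N\<^esub> x \<in> carrier N"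
    if "r \<in> carrier R" "x \<in> carrier N" for r x
    using that g linear_maps_smult[OF f, of r "?g x"] linear_maps_closed[OF f, of "r \<odot>\<^bsub>M\<^esub> ?g x"]
    by (auto intro: eq)
  ultimately show ?thesis
    using g by (auto simp: linear_maps_def)
qed

lemma module_regular:
  assumes "cring R"
  shows "module R (regular_module R)"
proof -
  interpret cring R by fact
  have "abelian_group (regular_module R)"
    by (rule abelian_groupI) (auto simp: regular_module_def a_ac intro: bexI[of _ "\<ominus>\<^bsub>R\<^esub> x" for x] l_neg)
  then show ?thesis
    by (intro moduleI[OF assms]) (auto simp: regular_module_def m_assoc l_distr r_distr)
qed

text \<open>The axioms hold componentwise. The work is in the finiteness of supports: sums,
  negatives and scalar multiples vanish wherever their arguments do.\<close>

lemma module_direct_sum: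
  assumes R: "cring R" and M: "\<And>i. i \<in> I \<Longrightarrow> module R (M i)"
  shows "module R (direct_sum I M)"
proof -
  have G: "abelian_group (M i)" if "i \<in> I" for i
    using M[OF that] by (simp add: module_def)
  note grp = abelian_group.axioms(1)[OF G]
  note closed = abelian_monoid.a_closed[OF grp] abelian_monoid.zero_closed[OF grp]
    module.smult_closed[OF M] abelian_group.a_inv_closed[OF G]
  have "abelian_group (direct_sum I M)"
  proof (rule abelian_groupI)
    fix f g assume "f \<in> carrier (direct_sum I M)" "g \<in> carrier (direct_sum I M)"
    moreover from this have "finite ({i \<in> I. f i \<noteq> \<zero>\<^bsub>M i\<^esub>} \<union> {i \<in> I. g i \<noteq> \<zero>\<^bsub>M i\<^esub>})"
      by (simp add: direct_sum_def)
    then have "finite {i \<in> I. f i \<oplus>\<^bsub>M i\<^esub> g i \<noteq> \<zero>\<^bsub>M i\<^esub>}"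
      by (rule rev_finite_subset)
        (auto simp: abelian_monoid.l_zero[OF grp] closed)
    ultimately show "f \<oplus>\<^bsub>direct_sum I M\<^esub> g \<in> carrier (direct_sum I M)"
      by (auto simp: direct_sum_def closed PiE_iff cong: conj_cong)
  next
    fix f assume f: "f \<in> carrier (direct_sum I M)"
    let ?g = "\<lambda>i\<in>I. \<ominus>\<^bsub>M i\<^esub> f i"
    have "finite {i \<in> I. \<ominus>\<^bsub>M i\<^esub> f i \<noteq> \<zero>\<^bsub>M i\<^esub>}"
      using f by (auto simp: direct_sum_def elim!: rev_finite_subset)
        (use G in \<open>metis closed(2) abelian_group.r_neg abelian_monoid.l_zero grp closed(4)\<close>)
    then have "?g \<in> carrier (direct_sum I M)"
      using f by (auto simp: direct_sum_def closed PiE_iff cong: conj_cong)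
    moreover have "?g \<oplus>\<^bsub>direct_sum I M\<^esub> f = \<zero>\<^bsub>direct_sum I M\<^esub>"
      using f by (auto simp: direct_sum_def PiE_iff abelian_group.l_neg[OF G] intro!: restrict_ext)
    ultimately show "\<exists>g\<in>carrier (direct_sum I M). g \<oplus>\<^bsub>direct_sum I M\<^esub> f = \<zero>\<^bsub>direct_sum I M\<^esub>"
      by blast
  next
    fix f g assume "f \<in> carrier (direct_sum I M)" "g \<in> carrier (direct_sum I M)"
    then show "f \<oplus>\<^bsub>direct_sum I M\<^esub> g = g \<oplus>\<^bsub>direct_sum I M\<^esub> f"
      by (auto simp: direct_sum_def PiE_iff abelian_monoid.a_comm[OF grp] intro!: restrict_ext)
  qed (auto simp: direct_sum_def PiE_iff closed abelian_monoid.a_assoc[OF grp]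
      abelian_monoid.l_zero[OF grp] extensional_def intro!: ext cong: conj_cong)
  then show ?thesis
  proof (rule moduleI[OF R])
    show "r \<odot>\<^bsub>direct_sum I M\<^esub> f \<in> carrier (direct_sum I M)"
    if "r \<in> carrier R" "f \<in> carrier (direct_sum I M)" for r f
  proof -
    have "finite {i \<in> I. f i \<noteq> \<zero>\<^bsub>M i\<^esub>}"
      using that by (simp add: direct_sum_def)
    then have "finite {i \<in> I. r \<odot>\<^bsub>M i\<^esub> f i \<noteq> \<zero>\<^bsub>M i\<^esub>}"
      by (rule rev_finite_subset) (auto simp: module.smult_r_null[OF M] that)
    then show ?thesis
      using that by (auto simp: direct_sum_def closed PiE_iff cong: conj_cong)
  qed
  qed (auto simp: direct_sum_def PiE_iff module.smult_l_distr[OF M] module.smult_r_distr[OF M]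
      module.smult_assoc1[OF M] module.smult_one[OF M] extensional_def intro!: ext)
qed

section \<open>Free modules over \<open>R1\<close> and their coordinates\<close>

abbreviation free_R1 :: "'i set \<Rightarrow> (real \<Rightarrow>\<^sub>0 'k::field, 'i \<Rightarrow> (real \<Rightarrow>\<^sub>0 'k)) module" where
  "free_R1 I \<equiv> direct_sum I (\<lambda>_. regular_module R1)"

lemma free_R1_simps:
  "carrier (free_R1 I) =
    {f \<in> I \<rightarrow>\<^sub>E {p. Poly_Mapping.keys p \<subseteq> {0..}}. finite {i \<in> I. f i \<noteq> 0}}"
  "\<zero>\<^bsub>free_R1 I\<^esub> = (\<lambda>i\<in>I. 0)"
  "f \<oplus>\<^bsub>free_R1 I\<^esub> g = (\<lambda>i\<in>I. f i + g i)"
  "r \<odot>\<^bsub>free_R1 I\<^esub> f = (\<lambda>i\<in>I. r * f i)"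
  by (simp_all add: direct_sum_def)

lemma module_free_R1: "module R1 (free_R1 I :: (real \<Rightarrow>\<^sub>0 'k::field, _) module)"
  by (intro module_direct_sum module_regular cring_R1)

text \<open>
  Coordinates \<open>c\<close> with respect to a basis \<open>\<beta>\<close>. The scalar action on the values of \<open>h\<close> may be
  twisted by \<open>s\<close>, so that the expansion also covers maps into the residue field.
\<close>

lemma free_module_coordinates:
  fixes M :: "(real \<Rightarrow>\<^sub>0 'k::field, 'm, 'z) module_scheme"
  assumes "free_module R1 M"
  obtains B :: "'m set" and \<beta> and c :: "'m \<Rightarrow> 'm \<Rightarrow> (real \<Rightarrow>\<^sub>0 'k)"
  where "\<And>b. b \<in> B \<Longrightarrow> \<beta> b \<in> carrier M"
    and "\<And>x. x \<in> carrier M \<Longrightarrow> finite {b \<in> B. c x b \<noteq> 0}"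
    and "\<And>x b. x \<in> carrier M \<Longrightarrow> b \<in> B \<Longrightarrow> Poly_Mapping.keys (c x b) \<subseteq> {0..}"
    and "\<And>x y b. x \<in> carrier M \<Longrightarrow> y \<in> carrier M \<Longrightarrow> b \<in> B \<Longrightarrow> c (x \<oplus>\<^bsub>M\<^esub> y) b = c x b + c y b"
    and "\<And>r x b. Poly_Mapping.keys r \<subseteq> {0..} \<Longrightarrow> x \<in> carrier M \<Longrightarrow> b \<in> B \<Longrightarrow>
      c (r \<odot>\<^bsub>M\<^esub> x) b = r * c x b"
    and "\<And>(h :: 'm \<Rightarrow> (real \<Rightarrow>\<^sub>0 'k)) s x.
      (\<And>x y. x \<in> carrier M \<Longrightarrow> y \<in> carrier M \<Longrightarrow> h (x \<oplus>\<^bsub>M\<^esub> y) = h x + h y) \<Longrightarrow>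
      (\<And>r x. Poly_Mapping.keys r \<subseteq> {0..} \<Longrightarrow> x \<in> carrier M \<Longrightarrow> h (r \<odot>\<^bsub>M\<^esub> x) = s r * h x) \<Longrightarrow>
      x \<in> carrier M \<Longrightarrow> h x = (\<Sum>b\<in>{b \<in> B. c x b \<noteq> 0}. s (c x b) * h (\<beta> b))"
proof -
  obtain B :: "'m set" and \<phi> where \<phi>: "\<phi> \<in> linear_maps R1 (free_R1 B) M"
    and bij: "bij_betw \<phi> (carrier (free_R1 B)) (carrier M)"
    using assms by (auto simp: free_module_def)
  define c where "c = (\<lambda>y\<in>carrier M. inv_into (carrier (free_R1 B)) \<phi> y)"
  have c: "c \<in> linear_maps R1 M (free_R1 B)"
    unfolding c_def by (rule inv_into_linear[OF module_free_R1 \<phi> bij])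
  \<comment> \<open>The unit vectors; their images under \<open>\<phi>\<close> are the
    basis.\<close>
  define \<delta> :: "'m \<Rightarrow> 'm \<Rightarrow> (real \<Rightarrow>\<^sub>0 'k)" where "\<delta> b = (\<lambda>i\<in>B. if i = b then 1 else 0)" for b
  have \<delta>: "\<delta> b \<in> carrier (free_R1 B)" if "b \<in> B" for b
    using that by (auto simp: free_R1_simps \<delta>_def)
  show thesis
  proof (rule that[of B "\<lambda>b. \<phi> (\<delta> b)" c])
    show "\<phi> (\<delta> b) \<in> carrier M" if "b \<in> B" for b
      using linear_maps_closed[OF \<phi> \<delta>[OF that]] .
    show "finite {b \<in> B. c x b \<noteq> 0}" if "x \<in> carrier M" for x
      using linear_maps_closed[OF c that] by (simp add: free_R1_simps)
    show "Poly_Mapping.keys (c x b) \<subseteq> {0..}" if "x \<in> carrier M" "b \<in> B" for x b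
      using linear_maps_closed[OF c that(1)] that(2) by (auto simp: free_R1_simps PiE_iff)
    show "c (x \<oplus>\<^bsub>M\<^esub> y) b = c x b + c y b" if "x \<in> carrier M" "y \<in> carrier M" "b \<in> B" for x y b
      using linear_maps_add[OF c that(1,2)] that(3) by (simp add: free_R1_simps)
    show "c (r \<odot>\<^bsub>M\<^esub> x) b = r * c x b"
      if "Poly_Mapping.keys r \<subseteq> {0..}" "x \<in> carrier M" "b \<in> B" for r x b
      using linear_maps_smult[OF c, of r x] that by (simp add: free_R1_simps)
    fix h :: "'m \<Rightarrow> (real \<Rightarrow>\<^sub>0 'k)" and s x
    assume add: "\<And>x y. x \<in> carrier M \<Longrightarrow> y \<in> carrier M \<Longrightarrow> h (x \<oplus>\<^bsub>M\<^esub> y) = h x + h y"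
      and smult: "\<And>r x. Poly_Mapping.keys r \<subseteq> {0..} \<Longrightarrow> x \<in> carrier M \<Longrightarrow> h (r \<odot>\<^bsub>M\<^esub> x) = s r * h x"
      and x: "x \<in> carrier M"
    \<comment> \<open>Induction on the support, with \<open>f\<close> arbitrary so that one
      component at a time can be cleared.\<close>
    have expand: "finite S \<Longrightarrow> f \<in> carrier (free_R1 B) \<Longrightarrow> S = {b \<in> B. f b \<noteq> 0} \<Longrightarrow>
      h (\<phi> f) = (\<Sum>b\<in>S. s (f b) * h (\<phi> (\<delta> b)))" for S f
    proof (induction S arbitrary: f rule: finite_induct)
      \<comment> \<open>Nothing is known about \<open>s 0\<close>, so \<open>h\<close> is shown to
        vanish at zero through additivity: \<open>f\<close> is its own double.\<close>
      case empty
      have "f \<oplus>\<^bsub>free_R1 B\<^esub> f = f"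
        using empty by (auto simp: free_R1_simps PiE_iff extensional_def intro!: ext)
      then have "h (\<phi> f) + h (\<phi> f) = h (\<phi> f)"
        using linear_maps_add[OF \<phi> empty(1) empty(1)] linear_maps_closed[OF \<phi> empty(1)]
        by (metis add)
      then have "h (\<phi> f) = 0"
        by (metis add_cancel_right_left)
      then show ?case
        by simp
    next
      case (insert b S)
      then have b: "b \<in> B" "Poly_Mapping.keys (f b) \<subseteq> {0..}"
        by (auto simp: free_R1_simps PiE_iff)
      let ?g = "f(b := 0)"
      have fin: "finite {i \<in> B. ?g i \<noteq> 0}"
        using insert.prems(1) by (auto simp: free_R1_simps elim!: rev_finite_subset)
      have g: "?g \<in> carrier (free_R1 B)" "S = {b \<in> B. ?g b \<noteq> 0}"
        using insert b fin by (auto simp: free_R1_simps PiE_iff extensional_def)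
      have d: "f b \<odot>\<^bsub>free_R1 B\<^esub> \<delta> b \<in> carrier (free_R1 B)"
        using module.smult_closed[OF module_free_R1, of "f b" "\<delta> b" B] b \<delta> by simp
      have "f = ?g \<oplus>\<^bsub>free_R1 B\<^esub> (f b \<odot>\<^bsub>free_R1 B\<^esub> \<delta> b)"
        using insert.prems(1) b
        by (auto simp: free_R1_simps \<delta>_def PiE_iff extensional_def intro!: ext)
      then have "h (\<phi> f) = h (\<phi> ?g \<oplus>\<^bsub>M\<^esub> \<phi> (f b \<odot>\<^bsub>free_R1 B\<^esub> \<delta> b))"
        using linear_maps_add[OF \<phi> g(1) d] by metis
      also have "\<dots> = h (\<phi> ?g) + h (f b \<odot>\<^bsub>M\<^esub> \<phi> (\<delta> b))"
        using add[OF linear_maps_closed[OF \<phi> g(1)] linear_maps_closed[OF \<phi> d]]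
          linear_maps_smult[OF \<phi>, of "f b" "\<delta> b"] b \<delta> by simp
      also have "h (f b \<odot>\<^bsub>M\<^esub> \<phi> (\<delta> b)) = s (f b) * h (\<phi> (\<delta> b))"
        using smult[OF b(2) linear_maps_closed[OF \<phi> \<delta>[OF b(1)]]] .
      also have "h (\<phi> ?g) = (\<Sum>i\<in>S. s (?g i) * h (\<phi> (\<delta> i)))"
        using insert.IH[OF g] .
      also have "\<dots> = (\<Sum>i\<in>S. s (f i) * h (\<phi> (\<delta> i)))"
        using insert.hyps by (intro sum.cong) auto
      finally show ?case
        using insert.hyps by (simp add: add.commute)
    qed
    have "\<phi> (c x) = x"
      using x bij by (simp add: c_def bij_betw_inv_into_right)
    then show "h x = (\<Sum>b\<in>{b \<in> B. c x b \<noteq> 0}. s (c x b) * h (\<phi> (\<delta> b)))"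
      using expand[OF _ linear_maps_closed[OF c x] refl] linear_maps_closed[OF c x]
      by (simp add: free_R1_simps)
  qed
qed

text \<open>Builds a linear map from coordinate functions \<open>c\<close> and freely prescribed
  values \<open>t\<close>. The lift, the truncations and the generator map below all have this
  shape.\<close>

lemma coordinate_extension_linear:
  fixes M :: "(real \<Rightarrow>\<^sub>0 'k::field, 'm, 'z) module_scheme" and t :: "'i \<Rightarrow> (real \<Rightarrow>\<^sub>0 'k)"
  assumes M: "module R1 M"
    and fin: "\<And>x. x \<in> carrier M \<Longrightarrow> finite {b \<in> B. c x b \<noteq> 0}"
    and add: "\<And>x y b. x \<in> carrier M \<Longrightarrow> y \<in> carrier M \<Longrightarrow> b \<in> B \<Longrightarrow> c (x \<oplus>\<^bsub>M\<^esub> y) b = c x b + c y b"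
    and smult: "\<And>r x b. Poly_Mapping.keys r \<subseteq> {0..} \<Longrightarrow> x \<in> carrier M \<Longrightarrow> b \<in> B \<Longrightarrow>
      c (r \<odot>\<^bsub>M\<^esub> x) b = r * c x b"
  defines "T \<equiv> \<lambda>x. \<Sum>b\<in>{b \<in> B. c x b \<noteq> 0}. c x b * t b"
  shows "x \<in> carrier M \<Longrightarrow> y \<in> carrier M \<Longrightarrow> T (x \<oplus>\<^bsub>M\<^esub> y) = T x + T y"
    and "Poly_Mapping.keys r \<subseteq> {0..} \<Longrightarrow> x \<in> carrier M \<Longrightarrow> T (r \<odot>\<^bsub>M\<^esub> x) = r * T x"
proof -
  interpret module R1 M by fact
  \<comment> \<open>The summation range of \<open>T\<close> depends on the argument. Terms outside
    the support vanish, so different arguments can be compared over a common finite set.\<close>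
  have T: "T x = (\<Sum>b\<in>S. c x b * t b)" if "finite S" "S \<subseteq> B" "{b \<in> B. c x b \<noteq> 0} \<subseteq> S" for x S
    unfolding T_def using that by (intro sum.mono_neutral_left) auto
  show "T (x \<oplus>\<^bsub>M\<^esub> y) = T x + T y" if x: "x \<in> carrier M" and y: "y \<in> carrier M"
  proof -
    let ?S = "{b \<in> B. c x b \<noteq> 0} \<union> {b \<in> B. c y b \<noteq> 0}"
    have S: "finite ?S" "?S \<subseteq> B"
      using fin x y by auto
    have "T (x \<oplus>\<^bsub>M\<^esub> y) = (\<Sum>b\<in>?S. (c x b + c y b) * t b)"
      using S add[OF x y] by (subst T[OF S]) (auto intro!: sum.cong)
    also have "\<dots> = T x + T y"
      by (subst (1 2) T[OF S]) (auto simp: distrib_right sum.distrib)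
    finally show ?thesis .
  qed
  show "T (r \<odot>\<^bsub>M\<^esub> x) = r * T x" if r: "Poly_Mapping.keys r \<subseteq> {0..}" and x: "x \<in> carrier M"
  proof -
    have "T (r \<odot>\<^bsub>M\<^esub> x) = (\<Sum>b\<in>{b \<in> B. c x b \<noteq> 0}. c (r \<odot>\<^bsub>M\<^esub> x) b * t b)"
      using fin[OF x] smult[OF r x] by (intro T) auto
    also have "\<dots> = (\<Sum>b\<in>{b \<in> B. c x b \<noteq> 0}. r * (c x b * t b))"
      using smult[OF r x] by (intro sum.cong) (auto simp: mult.assoc)
    finally show ?thesis
      by (simp add: T_def sum_distrib_left)
  qed
qed

section \<open>The residue field\<close>

text \<open>This is a coset of \<open>m1\<close>. Labelling the cosets by their constant
  coefficients identifies the quotient with the coefficient field.\<close>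

definition residue_class :: "'k \<Rightarrow> (real \<Rightarrow>\<^sub>0 'k::field) set" where
  "residue_class c = {p. Poly_Mapping.keys p \<subseteq> {0..} \<and> const_coeff p = c}"

lemma residue_class_zero: "residue_class 0 = m1"
proof -
  have "Poly_Mapping.keys p \<subseteq> {0<..} \<longleftrightarrow> Poly_Mapping.keys p \<subseteq> {0..} \<and> 0 \<notin> Poly_Mapping.keys p"
    for p :: "real \<Rightarrow>\<^sub>0 'a"
    by (auto simp: subset_iff order_le_less)
  then show ?thesis
    by (simp add: residue_class_def m1_def not_in_keys_iff_lookup_eq_zero)
qed

lemma const_in_residue_class: "Poly_Mapping.single 0 c \<in> residue_class c"
  by (simp add: residue_class_def)

lemma residue_class_inj: "residue_class c = residue_class d \<longleftrightarrow> c = d"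
proof
  assume "residue_class c = residue_class d"
  then have "Poly_Mapping.single 0 c \<in> residue_class d"
    using const_in_residue_class by blast
  then show "c = d"
    by (simp add: residue_class_def)
qed simp

lemma residue_class_add:
  assumes "p \<in> residue_class c" "q \<in> residue_class d"
  shows "p + q \<in> residue_class (c + d)"
  using assms keys_add_subset[of p "{0..}" q] by (simp add: residue_class_def lookup_add)

lemma residue_class_diff:
  assumes "p \<in> residue_class c" "q \<in> residue_class d"
  shows "p - q \<in> residue_class (c - d)"
  using assms keys_add_subset[of p "{0..}" "- q"] by (simp add: residue_class_def lookup_minus)

text \<open>Two elements of \<open>R1\<close> differ by an element of \<open>m1\<close> exactly when
  their constant coefficients agree.\<close>

lemma coset_m1:
  assumes "Poly_Mapping.keys p \<subseteq> {0..}"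
  shows "m1 +>\<^bsub>regular_module R1\<^esub> p = residue_class (const_coeff p)"
proof -
  have "q \<in> residue_class (const_coeff p) \<longleftrightarrow> (\<exists>h\<in>m1. q = h + p)" for q
  proof
    assume "q \<in> residue_class (const_coeff p)"
    then have "q - p \<in> m1"
      using residue_class_diff[of q _ p] assms
      unfolding residue_class_zero[symmetric] by (fastforce simp: residue_class_def)
    then show "\<exists>h\<in>m1. q = h + p"
      by (intro bexI[of _ "q - p"]) auto
  next
    assume "\<exists>h\<in>m1. q = h + p"
    then show "q \<in> residue_class (const_coeff p)"
      using residue_class_add[of _ 0 p "const_coeff p"] assms
      unfolding residue_class_zero[symmetric] by (auto simp: residue_class_def[of "const_coeff p"])
  qed
  then show ?thesis
    by (auto simp: a_r_coset_def')
qed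

lemma carrier_residue_field: "carrier residue_field = range residue_class"
proof -
  have "carrier residue_field =
      (\<lambda>p. residue_class (const_coeff p)) ` {p :: real \<Rightarrow>\<^sub>0 'a. Poly_Mapping.keys p \<subseteq> {0..}}"
    by (auto simp: residue_field_def quotient_module_def A_RCOSETS_def' coset_m1)
  also have "\<dots> = range residue_class"
  proof (intro equalityI subsetI)
    fix X :: "(real \<Rightarrow>\<^sub>0 'a) set" assume "X \<in> range residue_class"
    then obtain c where "X = residue_class c"
      by blast
    then show "X \<in> (\<lambda>p. residue_class (const_coeff p)) ` {p. Poly_Mapping.keys p \<subseteq> {0..}}"
      by (intro image_eqI[of _ _ "Poly_Mapping.single 0 c"]) auto
  qed auto
  finally show ?thesis .
qed

lemma residue_field_zero: "\<zero>\<^bsub>residue_field\<^esub> = residue_class 0"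
  by (simp add: residue_field_def quotient_module_def residue_class_zero)

lemma residue_field_add:
  "residue_class c \<oplus>\<^bsub>residue_field\<^esub> residue_class d = residue_class (c + d)"
proof -
  have "q \<in> residue_class (c + d) \<longleftrightarrow> (\<exists>h\<in>residue_class c. \<exists>k\<in>residue_class d. q = h + k)" for q
  proof
    assume "q \<in> residue_class (c + d)"
    from residue_class_diff[OF this const_in_residue_class[of d]]
    have "q - Poly_Mapping.single 0 d \<in> residue_class c"
      by simp
    then show "\<exists>h\<in>residue_class c. \<exists>k\<in>residue_class d. q = h + k"
      by (metis const_in_residue_class diff_add_cancel)
  qed (auto simp: residue_class_add)
  then show ?thesis
    by (auto simp: residue_field_def quotient_module_def set_add_def')
qed

text \<open>The action on the quotient is a union of cosets over all representatives. The constant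
  coefficient is multiplicative, so these cosets coincide, and the union is not empty because each
  class contains a constant.\<close>

lemma residue_field_smult:
  assumes r: "Poly_Mapping.keys r \<subseteq> {0..}"
  shows "r \<odot>\<^bsub>residue_field\<^esub> residue_class c = residue_class (const_coeff r * c)"
proof -
  have "m1 +>\<^bsub>regular_module R1\<^esub> (r * x) = residue_class (const_coeff r * c)"
    if "x \<in> residue_class c" for x
    using that r by (auto simp: residue_class_def[of c] coset_m1 keys_mult_nonneg const_coeff_mult)
  then show ?thesis
    using const_in_residue_class[of c] by (auto simp: residue_field_def quotient_module_def)
qed

lemmas residue_field_simps =
  carrier_residue_field residue_field_zero residue_field_add residue_field_smult residue_class_inj

section \<open>Lifting and truncating linear maps on free modules\<close>

definition residue_value :: "(real \<Rightarrow>\<^sub>0 'k::field) set \<Rightarrow> 'k" where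
  "residue_value = inv_into UNIV residue_class"

lemma residue_value [simp]: "residue_value (residue_class c) = c"
  unfolding residue_value_def by (rule inv_f_f) (simp add: inj_def residue_class_inj)

text \<open>Free modules are projective: send each basis element to the constant polynomial that
  represents its image under \<open>e\<close>, and extend linearly.\<close>

lemma lift_to_R1:
  fixes M :: "(real \<Rightarrow>\<^sub>0 'k::field, 'm, 'z) module_scheme"
  assumes free: "free_module R1 M" and e: "e \<in> linear_maps R1 M residue_field"
  obtains \<phi> where "\<And>x. x \<in> carrier M \<Longrightarrow> Poly_Mapping.keys (\<phi> x) \<subseteq> {0..}"
    and "\<And>x y. x \<in> carrier M \<Longrightarrow> y \<in> carrier M \<Longrightarrow> \<phi> (x \<oplus>\<^bsub>M\<^esub> y) = \<phi> x + \<phi> y"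
    and "\<And>r x. Poly_Mapping.keys r \<subseteq> {0..} \<Longrightarrow> x \<in> carrier M \<Longrightarrow> \<phi> (r \<odot>\<^bsub>M\<^esub> x) = r * \<phi> x"
    and "\<And>x. x \<in> carrier M \<Longrightarrow> e x = residue_class (const_coeff (\<phi> x))"
proof -
  have M: "module R1 M"
    using free by (simp add: free_module_def)
  \<comment> \<open>A lift of \<open>e\<close> by constants. It is additive but only semilinear, as
    scalars act through their constant coefficient; hence only its values on the basis enter
    \<open>\<phi>\<close>.\<close>
  define h where "h x = Poly_Mapping.single (0::real) (residue_value (e x))" for x
  have e_range: "\<exists>c. e x = residue_class c" if "x \<in> carrier M" for x
    using linear_maps_closed[OF e that] by (auto simp: residue_field_simps)
  have e_eq: "e x = residue_class (const_coeff (h x))" if "x \<in> carrier M" for x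
    using e_range[OF that] unfolding h_def lookup_single_eq by (metis residue_value)
  have h_add: "h (x \<oplus>\<^bsub>M\<^esub> y) = h x + h y" if x: "x \<in> carrier M" and y: "y \<in> carrier M" for x y
  proof -
    obtain c d where "e x = residue_class c" "e y = residue_class d"
      using e_range x y by metis
    then show ?thesis
      using linear_maps_add[OF e x y] by (simp add: h_def residue_field_add single_add)
  qed
  have h_smult: "h (r \<odot>\<^bsub>M\<^esub> x) = Poly_Mapping.single 0 (const_coeff r) * h x"
    if r: "Poly_Mapping.keys r \<subseteq> {0..}" and x: "x \<in> carrier M" for r x
  proof -
    obtain c where "e x = residue_class c"
      using e_range x by metis
    then show ?thesis
      using linear_maps_smult[OF e, of r x] r x by (simp add: h_def residue_field_smult mult_single)
  qed
  obtain B \<beta> and c :: "'m \<Rightarrow> 'm \<Rightarrow> (real \<Rightarrow>\<^sub>0 'k)"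
    where \<beta>: "\<And>b. b \<in> B \<Longrightarrow> \<beta> b \<in> carrier M"
    and fin: "\<And>x. x \<in> carrier M \<Longrightarrow> finite {b \<in> B. c x b \<noteq> 0}"
    and keys: "\<And>x b. x \<in> carrier M \<Longrightarrow> b \<in> B \<Longrightarrow> Poly_Mapping.keys (c x b) \<subseteq> {0..}"
    and add: "\<And>x y b. x \<in> carrier M \<Longrightarrow> y \<in> carrier M \<Longrightarrow> b \<in> B \<Longrightarrow> c (x \<oplus>\<^bsub>M\<^esub> y) b = c x b + c y b"
    and smult: "\<And>r x b. Poly_Mapping.keys r \<subseteq> {0..} \<Longrightarrow> x \<in> carrier M \<Longrightarrow> b \<in> B \<Longrightarrow>
      c (r \<odot>\<^bsub>M\<^esub> x) b = r * c x b"
    and expand: "\<And>(h :: 'm \<Rightarrow> (real \<Rightarrow>\<^sub>0 'k)) s x.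
      (\<And>x y. x \<in> carrier M \<Longrightarrow> y \<in> carrier M \<Longrightarrow> h (x \<oplus>\<^bsub>M\<^esub> y) = h x + h y) \<Longrightarrow>
      (\<And>r x. Poly_Mapping.keys r \<subseteq> {0..} \<Longrightarrow> x \<in> carrier M \<Longrightarrow> h (r \<odot>\<^bsub>M\<^esub> x) = s r * h x) \<Longrightarrow>
      x \<in> carrier M \<Longrightarrow> h x = (\<Sum>b\<in>{b \<in> B. c x b \<noteq> 0}. s (c x b) * h (\<beta> b))"
    using free by (rule free_module_coordinates) blast
  define \<phi> where "\<phi> x = (\<Sum>b\<in>{b \<in> B. c x b \<noteq> 0}. c x b * h (\<beta> b))" for x
  have h_keys: "Poly_Mapping.keys (h x) \<subseteq> {0..}" for x
    by (simp add: h_def)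
  note ext = coordinate_extension_linear[where t = "\<lambda>b. h (\<beta> b)", OF M fin add smult, folded \<phi>_def]
  show thesis
  proof (rule that[of \<phi>])
    show "Poly_Mapping.keys (\<phi> x) \<subseteq> {0..}" if "x \<in> carrier M" for x
      unfolding \<phi>_def using keys[OF that] h_keys by (intro keys_sum_subset keys_mult_nonneg) auto
    show "\<phi> (x \<oplus>\<^bsub>M\<^esub> y) = \<phi> x + \<phi> y" if "x \<in> carrier M" "y \<in> carrier M" for x y
      using ext(1) that by blast
    show "\<phi> (r \<odot>\<^bsub>M\<^esub> x) = r * \<phi> x" if "Poly_Mapping.keys r \<subseteq> {0..}" "x \<in> carrier M" for r x
      using ext(2) that by blast
    show "e x = residue_class (const_coeff (\<phi> x))" if x: "x \<in> carrier M" for x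
    proof -
      \<comment> \<open>Here the twist \<open>s\<close> of the basis expansion is the passage to the
        constant coefficient, so \<open>h x\<close> and \<open>\<phi> x\<close> expand into sums
        with the same constant terms.\<close>
      have "const_coeff (h x) = (\<Sum>b\<in>{b \<in> B. c x b \<noteq> 0}. const_coeff (c x b) * const_coeff (h (\<beta> b)))"
        using expand[of h "\<lambda>r. Poly_Mapping.single 0 (const_coeff r)" x, OF h_add h_smult x]
        by (simp add: lookup_sum const_coeff_mult h_keys)
      also have "\<dots> = const_coeff (\<phi> x)"
        unfolding \<phi>_def lookup_sum using keys[OF x] h_keys
        by (intro sum.cong) (auto simp: const_coeff_mult)
      finally show ?thesis
        using e_eq[OF x] by simp
    qed
  qed
qed

text \<open>
  The maps \<open>v k\<close> send a basis element \<open>b\<close> to \<open>h b\<close> if that lies in the \<open>k\<close>-th ideal and to \<open>0\<close>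
  otherwise.
\<close>

lemma truncated_maps:
  fixes M :: "(real \<Rightarrow>\<^sub>0 'k::field, 'm, 'z) module_scheme"
  assumes free: "free_module R1 M"
    and h_m1: "\<And>x. x \<in> carrier M \<Longrightarrow> h x \<in> m1"
    and h_add: "\<And>x y. x \<in> carrier M \<Longrightarrow> y \<in> carrier M \<Longrightarrow> h (x \<oplus>\<^bsub>M\<^esub> y) = h x + h y"
    and h_smult: "\<And>r x. Poly_Mapping.keys r \<subseteq> {0..} \<Longrightarrow> x \<in> carrier M \<Longrightarrow> h (r \<odot>\<^bsub>M\<^esub> x) = r * h x"
    and \<epsilon>: "\<epsilon> \<longlonglongrightarrow> (0::real)"
  obtains v :: "nat \<Rightarrow> 'm \<Rightarrow> (real \<Rightarrow>\<^sub>0 'k)"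
    where "\<And>k x. x \<in> carrier M \<Longrightarrow> Poly_Mapping.keys (v k x) \<subseteq> {\<epsilon> k..}"
    and "\<And>k x y. x \<in> carrier M \<Longrightarrow> y \<in> carrier M \<Longrightarrow> v k (x \<oplus>\<^bsub>M\<^esub> y) = v k x + v k y"
    and "\<And>k r x. Poly_Mapping.keys r \<subseteq> {0..} \<Longrightarrow> x \<in> carrier M \<Longrightarrow> v k (r \<odot>\<^bsub>M\<^esub> x) = r * v k x"
    and "\<And>x. x \<in> carrier M \<Longrightarrow> \<forall>\<^sub>F k in sequentially. v k x = h x"
proof -
  have M: "module R1 M"
    using free by (simp add: free_module_def)
  obtain B \<beta> and c :: "'m \<Rightarrow> 'm \<Rightarrow> (real \<Rightarrow>\<^sub>0 'k)"
    where \<beta>: "\<And>b. b \<in> B \<Longrightarrow> \<beta> b \<in> carrier M"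
    and fin: "\<And>x. x \<in> carrier M \<Longrightarrow> finite {b \<in> B. c x b \<noteq> 0}"
    and keys: "\<And>x b. x \<in> carrier M \<Longrightarrow> b \<in> B \<Longrightarrow> Poly_Mapping.keys (c x b) \<subseteq> {0..}"
    and add: "\<And>x y b. x \<in> carrier M \<Longrightarrow> y \<in> carrier M \<Longrightarrow> b \<in> B \<Longrightarrow> c (x \<oplus>\<^bsub>M\<^esub> y) b = c x b + c y b"
    and smult: "\<And>r x b. Poly_Mapping.keys r \<subseteq> {0..} \<Longrightarrow> x \<in> carrier M \<Longrightarrow> b \<in> B \<Longrightarrow>
      c (r \<odot>\<^bsub>M\<^esub> x) b = r * c x b"
    and expand: "\<And>(h :: 'm \<Rightarrow> (real \<Rightarrow>\<^sub>0 'k)) s x.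
      (\<And>x y. x \<in> carrier M \<Longrightarrow> y \<in> carrier M \<Longrightarrow> h (x \<oplus>\<^bsub>M\<^esub> y) = h x + h y) \<Longrightarrow>
      (\<And>r x. Poly_Mapping.keys r \<subseteq> {0..} \<Longrightarrow> x \<in> carrier M \<Longrightarrow> h (r \<odot>\<^bsub>M\<^esub> x) = s r * h x) \<Longrightarrow>
      x \<in> carrier M \<Longrightarrow> h x = (\<Sum>b\<in>{b \<in> B. c x b \<noteq> 0}. s (c x b) * h (\<beta> b))"
    using free by (rule free_module_coordinates) blast
  define t where "t k b = (if Poly_Mapping.keys (h (\<beta> b)) \<subseteq> {\<epsilon> k..} then h (\<beta> b) else 0)" for k b
  define v where "v k x = (\<Sum>b\<in>{b \<in> B. c x b \<noteq> 0}. c x b * t k b)" for k x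
  have t_keys: "Poly_Mapping.keys (t k b) \<subseteq> {\<epsilon> k..}" for k b
    by (simp add: t_def)
  \<comment> \<open>An element of \<open>m1\<close> has finitely many exponents, all positive.
    Eventually \<open>\<epsilon> k\<close> lies below each of them and the truncation keeps the
    value.\<close>
  have t_eventually: "\<forall>\<^sub>F k in sequentially. t k b = h (\<beta> b)" if "b \<in> B" for b
  proof -
    have "\<forall>\<^sub>F k in sequentially. \<forall>a\<in>Poly_Mapping.keys (h (\<beta> b)). \<epsilon> k < a"
      using h_m1[OF \<beta>[OF that]] order_tendstoD(2)[OF \<epsilon>]
      by (intro eventually_ball_finite) (auto simp: m1_def)
    then show ?thesis
      by eventually_elim (auto simp: t_def less_imp_le)
  qed
  note ext = coordinate_extension_linear[OF M fin add smult]
  show thesis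
  proof (rule that[of v])
    show "Poly_Mapping.keys (v k x) \<subseteq> {\<epsilon> k..}" if "x \<in> carrier M" for k x
      unfolding v_def using keys[OF that] t_keys by (intro keys_sum_subset keys_mult_nonneg) auto
    show "v k (x \<oplus>\<^bsub>M\<^esub> y) = v k x + v k y" if "x \<in> carrier M" "y \<in> carrier M" for k x y
      unfolding v_def using ext(1) that by blast
    show "v k (r \<odot>\<^bsub>M\<^esub> x) = r * v k x" if "Poly_Mapping.keys r \<subseteq> {0..}" "x \<in> carrier M" for k r x
      unfolding v_def using ext(2) that by blast
    \<comment> \<open>Only finitely many basis elements occur in \<open>x\<close>, so from some
      index on none of their values is cut off.\<close>
    show "\<forall>\<^sub>F k in sequentially. v k x = h x" if x: "x \<in> carrier M" for x
    proof -
      have "\<forall>\<^sub>F k in sequentially. \<forall>b\<in>{b \<in> B. c x b \<noteq> 0}. t k b = h (\<beta> b)"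
        using fin[OF x] t_eventually by (intro eventually_ball_finite) auto
      then show ?thesis
      proof eventually_elim
        case (elim k)
        have "v k x = (\<Sum>b\<in>{b \<in> B. c x b \<noteq> 0}. c x b * h (\<beta> b))"
          unfolding v_def using elim by (intro sum.cong) auto
        then show ?case
          using expand[of h "\<lambda>r. r" x, OF h_add h_smult x] by simp
      qed
    qed
  qed
qed

section \<open>Nonvanishing of Ext\<close>

lemma zero_linear:
  assumes "module R M" "module R N"
  shows "(\<lambda>x\<in>carrier M. \<zero>\<^bsub>N\<^esub>) \<in> linear_maps R M N"
proof -
  interpret M: module R M by fact
  interpret N: module R N by fact
  show ?thesis
    by (auto simp: linear_maps_def)
qed

text \<open>The zero of the quotient is the set of coboundaries itself. The zero map is a
  coboundary, so \<open>u\<close> lies in its own coset; this coset is then not the zero one, as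
  \<open>u\<close> is no coboundary.\<close>

lemma Hom_cohomology_nonzero:
  assumes P: "\<And>m. d m \<in> linear_maps R (P (Suc m)) (P m)" "\<And>n. module R (P n)"
    and N: "module R N"
    and u: "u \<in> cocycles R P d N n" "u \<notin> coboundaries R P d N n"
  shows "carrier (Hom_cohomology R P d N n) \<noteq> {\<zero>\<^bsub>Hom_cohomology R P d N n\<^esub>}"
proof -
  interpret N: module R N by fact
  let ?Z = "(Hom_module R (P n) N)\<lparr>carrier := cocycles R P d N n\<rparr>"
  let ?B = "coboundaries R P d N n"
  let ?O = "\<lambda>x\<in>carrier (P n). \<zero>\<^bsub>N\<^esub>"
  have zero: "?O \<in> ?B"
  proof (cases n)
    case 0
    then show ?thesis
      by (simp add: Hom_module_def)
  next
    case (Suc m)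
    have "?O = compose (carrier (P (Suc m))) (\<lambda>x\<in>carrier (P m). \<zero>\<^bsub>N\<^esub>) (d m)"
      using linear_maps_closed[OF P(1)[of m]] Suc by (auto simp: compose_def intro!: restrict_ext)
    then show ?thesis
      using zero_linear[OF P(2) N] Suc by simp
  qed
  have "u \<in> carrier (P n) \<rightarrow>\<^sub>E carrier N"
    using u(1) by (simp add: cocycles_def linear_maps_def)
  then have "?O \<oplus>\<^bsub>?Z\<^esub> u = u"
    by (auto simp: Hom_module_def PiE_iff extensional_def intro!: ext)
  then have "u \<in> ?B +>\<^bsub>?Z\<^esub> u"
    using zero unfolding a_r_coset_def' by force
  moreover have "?B +>\<^bsub>?Z\<^esub> u \<in> carrier (Hom_cohomology R P d N n)"
    using u(1) by (auto simp: Hom_cohomology_def quotient_module_def A_RCOSETS_def')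
  moreover have "\<zero>\<^bsub>Hom_cohomology R P d N n\<^esub> = ?B"
    by (simp add: Hom_cohomology_def quotient_module_def)
  ultimately show ?thesis
    using u(2) by auto
qed

section \<open>The module \<open>F_module\<close> and the obstruction cocycle\<close>

lemma F_module_simps:
  "carrier (F_module \<epsilon>) =
    {f. (\<forall>k. Poly_Mapping.keys (f k) \<subseteq> {\<epsilon> k..}) \<and> finite {k. f k \<noteq> 0}}"
  "\<zero>\<^bsub>F_module \<epsilon>\<^esub> = (\<lambda>k. 0)"
  "f \<oplus>\<^bsub>F_module \<epsilon>\<^esub> g = (\<lambda>k. f k + g k)"
  "r \<odot>\<^bsub>F_module \<epsilon>\<^esub> f = (\<lambda>k. r * f k)"
  by (simp_all add: F_module_def direct_sum_def PIdl_xpow PiE_UNIV_domain Pi_iff restrict_UNIV)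

lemma module_F_module:
  assumes "\<And>k. 0 \<le> \<epsilon> k"
  shows "module R1 (F_module \<epsilon> :: (real \<Rightarrow>\<^sub>0 'k::field, _) module)"
  unfolding F_module_def
proof (rule module_direct_sum[OF cring_R1], rule moduleI[OF cring_R1])
  fix k
  let ?I = "(regular_module R1)\<lparr>carrier := PIdl\<^bsub>R1\<^esub> (xpow (\<epsilon> k) :: real \<Rightarrow>\<^sub>0 'k)\<rparr>"
  show "abelian_group ?I"
  proof (rule abelian_groupI)
    show "\<exists>y\<in>carrier ?I. y \<oplus>\<^bsub>?I\<^esub> x = \<zero>\<^bsub>?I\<^esub>" if "x \<in> carrier ?I" for x
      using that by (intro bexI[of _ "- x"]) (simp_all add: PIdl_xpow)
  qed (simp_all add: PIdl_xpow keys_add_subset algebra_simps)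
qed (simp_all add: PIdl_xpow keys_mult_nonneg algebra_simps)

text \<open>\<open>Ext\<close> takes its resolution by choice, so the obstruction has to be found in
  an arbitrary free resolution, using exactness alone.\<close>

lemma obstruction_cocycle:
  fixes P :: "nat \<Rightarrow> (real \<Rightarrow>\<^sub>0 'k::field, 'p, 'w) module_scheme" and \<epsilon> :: "nat \<Rightarrow> real"
  assumes res: "free_resolution R1 residue_field P d e"
    and pos: "\<And>k. \<epsilon> k > 0" and anti: "strict_antimono_on UNIV \<epsilon>" and lim: "\<epsilon> \<longlonglongrightarrow> 0"
  obtains u where "u \<in> cocycles R1 P d (F_module \<epsilon>) 2" "u \<notin> coboundaries R1 P d (F_module \<epsilon>) 2"
proof -
  note One_nat_def [simp del]
  have suc: "Suc 0 = 1" "Suc 1 = 2" "Suc 2 = 3"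
    by simp_all
  have free: "free_module R1 (P n)" and d: "d n \<in> linear_maps R1 (P (Suc n)) (P n)"
    and e: "e \<in> linear_maps R1 (P 0) residue_field" and e_surj: "e ` carrier (P 0) = carrier residue_field"
    and exact0: "a_kernel (P 0) residue_field e = d 0 ` carrier (P 1)"
    and exact: "a_kernel (P (Suc n)) (P n) (d n) = d (Suc n) ` carrier (P (Suc (Suc n)))" for n
    using res by (auto simp: free_resolution_def)
  have M: "module R1 (P n)" for n
    using free by (simp add: free_module_def)
  interpret P0: module R1 "P 0" by (rule M)
  interpret P1: module R1 "P 1" by (rule M)
  have d0: "d 0 \<in> linear_maps R1 (P 1) (P 0)" and d1: "d 1 \<in> linear_maps R1 (P 2) (P 1)"
    and d2: "d 2 \<in> linear_maps R1 (P 3) (P 2)"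
    using d[of 0] d[of 1] d[of 2] by (simp_all add: suc)
  have ker_e: "e x = residue_class 0 \<longleftrightarrow> x \<in> d 0 ` carrier (P 1)" if "x \<in> carrier (P 0)" for x
    using that unfolding exact0[symmetric] by (simp add: a_kernel_def' residue_field_zero)
  have ker_d0: "d 0 x = \<zero>\<^bsub>P 0\<^esub> \<longleftrightarrow> x \<in> d 1 ` carrier (P 2)" if "x \<in> carrier (P 1)" for x
    using that exact[of 0] by (auto simp: a_kernel_def' suc)
  have ker_d1: "d 1 (d 2 x) = \<zero>\<^bsub>P 1\<^esub>" if "x \<in> carrier (P 3)" for x
    using that exact[of 1] by (auto simp: a_kernel_def' suc)
  obtain \<phi> where \<phi>_keys: "\<And>x. x \<in> carrier (P 0) \<Longrightarrow> Poly_Mapping.keys (\<phi> x) \<subseteq> {0..}"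
    and \<phi>_add: "\<And>x y. x \<in> carrier (P 0) \<Longrightarrow> y \<in> carrier (P 0) \<Longrightarrow> \<phi> (x \<oplus>\<^bsub>P 0\<^esub> y) = \<phi> x + \<phi> y"
    and \<phi>_smult: "\<And>r x. Poly_Mapping.keys r \<subseteq> {0..} \<Longrightarrow> x \<in> carrier (P 0) \<Longrightarrow>
      \<phi> (r \<odot>\<^bsub>P 0\<^esub> x) = r * \<phi> x"
    and e_eq: "\<And>x. x \<in> carrier (P 0) \<Longrightarrow> e x = residue_class (const_coeff (\<phi> x))"
    by (rule lift_to_R1[OF free e]) (rule that)
  have \<phi>_zero: "\<phi> \<zero>\<^bsub>P 0\<^esub> = 0"
    using \<phi>_smult[of 0 "\<zero>\<^bsub>P 0\<^esub>"] P0.smult_l_null[of "\<zero>\<^bsub>P 0\<^esub>"] by simp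
  define h where "h x = \<phi> (d 0 x)" for x
  \<comment> \<open>\<open>e\<close> kills the image of \<open>d 0\<close>, so the lift has constant
    coefficient 0 there.\<close>
  have h_m1: "h x \<in> m1" if x: "x \<in> carrier (P 1)" for x
  proof -
    have "residue_class (const_coeff (h x)) = residue_class 0"
      using e_eq ker_e linear_maps_closed[OF d0 x] x by (metis h_def image_eqI)
    then show ?thesis
      using \<phi>_keys[OF linear_maps_closed[OF d0 x]]
      by (simp add: residue_class_zero[symmetric] residue_class_inj) (simp add: residue_class_def h_def)
  qed
  have h_add: "h (x \<oplus>\<^bsub>P 1\<^esub> y) = h x + h y" if "x \<in> carrier (P 1)" "y \<in> carrier (P 1)" for x y
    using linear_maps_add[OF d0] linear_maps_closed[OF d0] \<phi>_add that by (simp add: h_def)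
  have h_smult: "h (r \<odot>\<^bsub>P 1\<^esub> x) = r * h x"
    if "Poly_Mapping.keys r \<subseteq> {0..}" "x \<in> carrier (P 1)" for r x
    using linear_maps_smult[OF d0, of r x] linear_maps_closed[OF d0] \<phi>_smult that
    by (simp add: h_def)
  obtain v :: "nat \<Rightarrow> 'p \<Rightarrow> (real \<Rightarrow>\<^sub>0 'k)"
    where v_keys: "\<And>k x. x \<in> carrier (P 1) \<Longrightarrow> Poly_Mapping.keys (v k x) \<subseteq> {\<epsilon> k..}"
    and v_add: "\<And>k x y. x \<in> carrier (P 1) \<Longrightarrow> y \<in> carrier (P 1) \<Longrightarrow>
      v k (x \<oplus>\<^bsub>P 1\<^esub> y) = v k x + v k y"
    and v_smult: "\<And>k r x. Poly_Mapping.keys r \<subseteq> {0..} \<Longrightarrow> x \<in> carrier (P 1) \<Longrightarrow>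
      v k (r \<odot>\<^bsub>P 1\<^esub> x) = r * v k x"
    and v_h: "\<And>x. x \<in> carrier (P 1) \<Longrightarrow> \<forall>\<^sub>F k in sequentially. v k x = h x"
    by (rule truncated_maps[of "P 1" h \<epsilon>, OF free h_m1 h_add h_smult lim]) (assumption+, blast)
  have v_zero: "v k \<zero>\<^bsub>P 1\<^esub> = 0" for k
    using v_smult[of 0 "\<zero>\<^bsub>P 1\<^esub>" k] P1.smult_l_null[of "\<zero>\<^bsub>P 1\<^esub>"] by simp
  define u where "u = (\<lambda>x\<in>carrier (P 2). \<lambda>k. v k (d 1 x))"
  \<comment> \<open>\<open>d 0\<close> kills the image of \<open>d 1\<close>, hence so does
    \<open>h\<close>. The components of \<open>v\<close> agree with \<open>h\<close> for large
    \<open>k\<close>, which puts the values of \<open>u\<close> into the direct sum.\<close>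
  have finite_v: "finite {k. v k (d 1 x) \<noteq> 0}" if x: "x \<in> carrier (P 2)" for x
  proof -
    have "h (d 1 x) = 0"
      using ker_d0[OF linear_maps_closed[OF d1 x]] x \<phi>_zero by (auto simp: h_def)
    then have "\<forall>\<^sub>F k in sequentially. v k (d 1 x) = 0"
      using v_h[OF linear_maps_closed[OF d1 x]] by simp
    then show ?thesis
      by (simp add: eventually_cofinite cofinite_eq_sequentially[symmetric])
  qed
  have u_carrier: "u x \<in> carrier (F_module \<epsilon>)" if x: "x \<in> carrier (P 2)" for x
    using v_keys[OF linear_maps_closed[OF d1 x]] finite_v[OF x] x by (simp add: u_def F_module_simps)
  interpret P2: module R1 "P 2" by (rule M)
  have u_linear: "u \<in> linear_maps R1 (P 2) (F_module \<epsilon>)"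
    unfolding linear_maps_def
  proof (intro CollectI conjI ballI)
    show "u \<in> carrier (P 2) \<rightarrow>\<^sub>E carrier (F_module \<epsilon>)"
      using u_carrier by (auto simp: u_def)
    show "u (x \<oplus>\<^bsub>P 2\<^esub> y) = u x \<oplus>\<^bsub>F_module \<epsilon>\<^esub> u y"
      if "x \<in> carrier (P 2)" "y \<in> carrier (P 2)" for x y
      using that linear_maps_add[OF d1] linear_maps_closed[OF d1] v_add
      by (simp add: u_def F_module_simps)
    show "u (r \<odot>\<^bsub>P 2\<^esub> x) = r \<odot>\<^bsub>F_module \<epsilon>\<^esub> u x"
      if "r \<in> carrier R1" "x \<in> carrier (P 2)" for r x
      using that linear_maps_smult[OF d1, of r x] linear_maps_closed[OF d1] v_smult
        P2.smult_closed[of r x]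
      by (simp add: u_def F_module_simps)
  qed
  have "compose (carrier (P 3)) u (d 2) = \<zero>\<^bsub>Hom_module R1 (P 3) (F_module \<epsilon>)\<^esub>"
    using linear_maps_closed[OF d2] ker_d1 v_zero
    by (auto simp: compose_def Hom_module_def u_def F_module_simps intro!: restrict_ext)
  then have "u \<in> cocycles R1 P d (F_module \<epsilon>) 2"
    using u_linear by (simp add: cocycles_def suc)
  moreover have "u \<notin> coboundaries R1 P d (F_module \<epsilon>) 2"
  proof
    assume "u \<in> coboundaries R1 P d (F_module \<epsilon>) 2"
    then have "\<exists>g\<in>linear_maps R1 (P 1) (F_module \<epsilon>). u = compose (carrier (P 2)) g (d 1)"
      using coboundaries.simps(2)[of R1 P d "F_module \<epsilon>" 1] by (auto simp: suc)
    then obtain g where g: "g \<in> linear_maps R1 (P 1) (F_module \<epsilon>)"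
      and u_eq: "u = compose (carrier (P 2)) g (d 1)"
      by blast
    define w where "w k x = v k x - g x k" for k x
    have w_add: "w k (x \<oplus>\<^bsub>P 1\<^esub> y) = w k x + w k y"
      if "x \<in> carrier (P 1)" "y \<in> carrier (P 1)" for k x y
      using linear_maps_add[OF g that] v_add[OF that] by (simp add: w_def F_module_simps)
    have w_smult: "w k (r \<odot>\<^bsub>P 1\<^esub> x) = r * w k x"
      if "Poly_Mapping.keys r \<subseteq> {0..}" "x \<in> carrier (P 1)" for k r x
      using linear_maps_smult[OF g, of r x] v_smult[OF that] that
      by (simp add: w_def F_module_simps right_diff_distrib)
    have w_keys: "Poly_Mapping.keys (w k x) \<subseteq> {\<epsilon> k..}" if "x \<in> carrier (P 1)" for k x
      using v_keys[OF that, of k] linear_maps_closed[OF g that]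
        keys_add_subset[of "v k x" "{\<epsilon> k..}" "- g x k"] by (simp add: w_def F_module_simps)
    \<comment> \<open>By exactness \<open>x\<close> comes from \<open>P 2\<close>, and on the image
      of \<open>d 1\<close> the maps \<open>v\<close> and \<open>g\<close> agree by
      \<open>u_eq\<close>.\<close>
    have w_ker: "w k x = 0" if x: "x \<in> carrier (P 1)" "d 0 x = \<zero>\<^bsub>P 0\<^esub>" for k x
    proof -
      obtain y where y: "y \<in> carrier (P 2)" "x = d 1 y"
        using ker_d0[OF x(1)] x(2) by auto
      have "u y k = g x k"
        unfolding u_eq using y by (simp add: compose_def)
      moreover have "u y k = v k x"
        using y by (simp add: u_def)
      ultimately show ?thesis
        by (simp add: w_def)
    qed
    have "residue_class (1::'k) \<in> e ` carrier (P 0)"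
      unfolding e_surj by (simp add: carrier_residue_field)
    then obtain p where p: "p \<in> carrier (P 0)" "e p = residue_class 1"
      by auto
    then have \<phi>_p: "const_coeff (\<phi> p) = 1"
      using e_eq[OF p(1)] by (simp add: residue_class_inj)
    \<comment> \<open>As \<open>\<epsilon> n > 0\<close>, the monomial acts as 0 on the residue
      field. So the multiple of \<open>p\<close> lies in the kernel of \<open>e\<close>, which is
      the image of \<open>d 0\<close>.\<close>
    have in_range: "xpow (\<epsilon> n) \<odot>\<^bsub>P 0\<^esub> p \<in> d 0 ` carrier (P 1)" for n
    proof -
      have "const_coeff (xpow (\<epsilon> n) :: real \<Rightarrow>\<^sub>0 'k) = 0"
        using pos[of n] by (simp add: xpow_def lookup_single)
      then have "e (xpow (\<epsilon> n) \<odot>\<^bsub>P 0\<^esub> p) = residue_class 0"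
        using linear_maps_smult[OF e, of "xpow (\<epsilon> n)" p] p pos[of n]
        by (simp add: residue_field_smult)
      then show ?thesis
        using ker_e P0.smult_closed[of "xpow (\<epsilon> n)" p] p pos[of n] by simp
    qed
    define a where "a n = inv_into (carrier (P 1)) (d 0) (xpow (\<epsilon> n) \<odot>\<^bsub>P 0\<^esub> p)" for n
    have a: "a n \<in> carrier (P 1)" "d 0 (a n) = xpow (\<epsilon> n) \<odot>\<^bsub>P 0\<^esub> p" for n
      unfolding a_def by (rule inv_into_into[OF in_range], rule f_inv_into_f[OF in_range])
    have vanish: "Poly_Mapping.lookup (w k (a 0)) (\<epsilon> 0) = 0" for k
    proof -
      \<comment> \<open>Going one index past \<open>k\<close> gives
        \<open>\<epsilon> ?m < \<epsilon> k\<close>. A factor \<open>xpow ?c\<close> times an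
        element of the \<open>k\<close>-th ideal then has all exponents above
        \<open>\<epsilon> 0\<close>.\<close>
      let ?m = "Suc k"
      let ?c = "\<epsilon> 0 - \<epsilon> ?m"
      have less: "\<epsilon> ?m < \<epsilon> k" "0 \<le> ?c"
        using anti by (auto simp: monotone_on_def less_imp_le)
      let ?r = "- xpow ?c :: real \<Rightarrow>\<^sub>0 'k"
      \<comment> \<open>Both \<open>a 0\<close> and \<open>xpow ?c\<close> times \<open>a ?m\<close>
        are mapped by \<open>d 0\<close> to \<open>xpow (\<epsilon> 0)\<close> times
        \<open>p\<close>, so their difference \<open>?y\<close> lies in the kernel.\<close>
      let ?y = "a 0 \<oplus>\<^bsub>P 1\<^esub> (?r \<odot>\<^bsub>P 1\<^esub> a ?m)"
      have r: "Poly_Mapping.keys ?r \<subseteq> {0..}"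
        using less by simp
      have ra: "?r \<odot>\<^bsub>P 1\<^esub> a ?m \<in> carrier (P 1)"
        using P1.smult_closed r a by simp
      have "d 0 ?y = (xpow (\<epsilon> 0) \<odot>\<^bsub>P 0\<^esub> p) \<oplus>\<^bsub>P 0\<^esub> (?r \<odot>\<^bsub>P 0\<^esub> (xpow (\<epsilon> ?m) \<odot>\<^bsub>P 0\<^esub> p))"
        using linear_maps_add[OF d0 a(1) ra] linear_maps_smult[OF d0 _ a(1), of ?r] r a by simp
      also have "\<dots> = (xpow (\<epsilon> 0) + ?r * xpow (\<epsilon> ?m)) \<odot>\<^bsub>P 0\<^esub> p"
        using P0.smult_assoc1[of ?r "xpow (\<epsilon> ?m)" p] P0.smult_l_distr[of "xpow (\<epsilon> 0)" "?r * xpow (\<epsilon> ?m)" p]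
          r p pos less_imp_le[OF pos] keys_mult_nonneg[OF r, of "xpow (\<epsilon> ?m)" 0] by simp
      also have "xpow (\<epsilon> 0) + ?r * xpow (\<epsilon> ?m) = 0"
        by (simp add: xpow_mult)
      also have "0 \<odot>\<^bsub>P 0\<^esub> p = \<zero>\<^bsub>P 0\<^esub>"
        using P0.smult_l_null[OF p(1)] by simp
      finally have "w k ?y = 0"
        using w_ker P1.a_closed[OF a(1) ra] by blast
      then have "w k (a 0) = xpow ?c * w k (a ?m)"
        using w_add[OF a(1) ra] w_smult[OF r a(1)] by simp
      then have "Poly_Mapping.keys (w k (a 0)) \<subseteq> {?c + \<epsilon> k..}"
        using keys_mult_atLeast[of "xpow ?c" ?c "w k (a ?m)" "\<epsilon> k"] w_keys[OF a(1)] by simp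
      then have "\<epsilon> 0 \<notin> Poly_Mapping.keys (w k (a 0))"
        using less by auto
      then show ?thesis
        by (simp add: not_in_keys_iff_lookup_eq_zero)
    qed
    \<comment> \<open>This is where direct sum and product differ: \<open>g (a 0)\<close> has finite
      support, so it cannot correct \<open>v k (a 0)\<close> for large \<open>k\<close>.\<close>
    have "\<forall>\<^sub>F k in sequentially. g (a 0) k = 0"
      using linear_maps_closed[OF g a(1)[of 0]]
      by (simp add: F_module_simps cofinite_eq_sequentially[symmetric] eventually_cofinite)
    then have "\<forall>\<^sub>F k in sequentially. w k (a 0) = h (a 0)"
      using v_h[OF a(1)[of 0]] by eventually_elim (simp add: w_def)
    then obtain k where "w k (a 0) = h (a 0)"
      by (auto simp: eventually_sequentially)
    also have "\<dots> = xpow (\<epsilon> 0) * \<phi> p"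
      using \<phi>_smult[of "xpow (\<epsilon> 0)" p] p pos[of 0] by (simp add: h_def a)
    finally show False
      using vanish[of k] lookup_xpow_mult[OF \<phi>_keys[OF p(1)]] \<phi>_p by simp
  qed
  ultimately show thesis
    by (rule that)
qed

section \<open>A free resolution of length two\<close>

text \<open>\<open>free_module\<close> asks for a basis inside the module, so the index set
  \<open>I\<close> is replaced by the set of unit vectors. \<open>\<phi>\<close> and
  \<open>\<psi>\<close> reindex along the injection \<open>\<delta>\<close>.\<close>

lemma free_module_free_R1: "free_module R1 (free_R1 I :: (real \<Rightarrow>\<^sub>0 'k::field, 'i \<Rightarrow> _) module)"
proof -
  define \<delta> :: "'i \<Rightarrow> 'i \<Rightarrow> (real \<Rightarrow>\<^sub>0 'k)" where "\<delta> i = (\<lambda>j\<in>I. if j = i then 1 else 0)" for i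
  have inj: "inj_on \<delta> I"
  proof (rule inj_onI)
    fix i j assume "i \<in> I" "j \<in> I" "\<delta> i = \<delta> j"
    then have "\<delta> j i = \<delta> i i"
      by (simp only:)
    then show "i = j"
      using \<open>i \<in> I\<close> by (simp add: \<delta>_def split: if_splits)
  qed
  let ?B = "\<delta> ` I"
  define \<phi> where "\<phi> = (\<lambda>f\<in>carrier (free_R1 ?B). \<lambda>i\<in>I. f (\<delta> i) :: real \<Rightarrow>\<^sub>0 'k)"
  define \<psi> where "\<psi> g = (\<lambda>b\<in>?B. g (inv_into I \<delta> b) :: real \<Rightarrow>\<^sub>0 'k)" for g
  interpret B: module R1 "free_R1 ?B :: (real \<Rightarrow>\<^sub>0 'k, _) module" by (rule module_free_R1)
  have \<phi>_carrier: "\<phi> f \<in> carrier (free_R1 I)" if f: "f \<in> carrier (free_R1 ?B)" for f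
  proof -
    have "\<delta> ` {i \<in> I. f (\<delta> i) \<noteq> 0} \<subseteq> {b \<in> ?B. f b \<noteq> 0}"
      by auto
    moreover have "finite {b \<in> ?B. f b \<noteq> 0}"
      using f by (simp add: free_R1_simps)
    ultimately have "finite (\<delta> ` {i \<in> I. f (\<delta> i) \<noteq> 0})"
      by (rule finite_subset)
    then have "finite {i \<in> I. f (\<delta> i) \<noteq> 0}"
      by (rule finite_imageD) (rule inj_on_subset[OF inj], blast)
    then show ?thesis
      using f by (simp add: \<phi>_def) (auto simp: free_R1_simps PiE_iff cong: conj_cong)
  qed
  have \<psi>_carrier: "\<psi> g \<in> carrier (free_R1 ?B)" if g: "g \<in> carrier (free_R1 I)" for g
  proof -
    have "{b \<in> ?B. g (inv_into I \<delta> b) \<noteq> 0} \<subseteq> \<delta> ` {i \<in> I. g i \<noteq> 0}"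
      using inj by auto
    moreover have "finite (\<delta> ` {i \<in> I. g i \<noteq> 0})"
      using g by (simp add: free_R1_simps)
    ultimately have "finite {b \<in> ?B. g (inv_into I \<delta> b) \<noteq> 0}"
      by (rule finite_subset)
    then show ?thesis
      using g inj by (auto simp: \<psi>_def free_R1_simps PiE_iff cong: conj_cong)
  qed
  have "bij_betw \<phi> (carrier (free_R1 ?B)) (carrier (free_R1 I))"
  proof (rule bij_betw_byWitness[where f' = \<psi>])
    show "\<forall>f\<in>carrier (free_R1 ?B). \<psi> (\<phi> f) = f"
    proof
      fix f :: "('i \<Rightarrow> real \<Rightarrow>\<^sub>0 'k) \<Rightarrow> (real \<Rightarrow>\<^sub>0 'k)" assume f: "f \<in> carrier (free_R1 ?B)"
      then have "\<psi> (\<phi> f) = (\<lambda>b\<in>?B. f b)"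
        using inj by (auto simp: \<psi>_def \<phi>_def intro!: restrict_ext)
      then show "\<psi> (\<phi> f) = f"
        using f by (simp add: free_R1_simps PiE_iff extensional_restrict)
    qed
    show "\<forall>g\<in>carrier (free_R1 I). \<phi> (\<psi> g) = g"
    proof
      fix g :: "'i \<Rightarrow> (real \<Rightarrow>\<^sub>0 'k)" assume g: "g \<in> carrier (free_R1 I)"
      then have "\<phi> (\<psi> g) = (\<lambda>i\<in>I. g i)"
        unfolding \<phi>_def using \<psi>_carrier[OF g] inj by (auto simp: \<psi>_def intro!: restrict_ext)
      then show "\<phi> (\<psi> g) = g"
        using g by (simp add: free_R1_simps PiE_iff extensional_restrict)
    qed
  qed (use \<phi>_carrier \<psi>_carrier in auto)
  moreover have "\<phi> \<in> linear_maps R1 (free_R1 ?B) (free_R1 I)"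
    unfolding linear_maps_def
  proof (intro CollectI conjI ballI)
    show "\<phi> \<in> carrier (free_R1 ?B) \<rightarrow>\<^sub>E carrier (free_R1 I)"
      using \<phi>_carrier by (simp add: \<phi>_def PiE_iff)
    show "\<phi> (f \<oplus>\<^bsub>free_R1 ?B\<^esub> g) = \<phi> f \<oplus>\<^bsub>free_R1 I\<^esub> \<phi> g"
      if "f \<in> carrier (free_R1 ?B)" "g \<in> carrier (free_R1 ?B)" for f g
      using that B.a_closed[OF that] by (simp add: \<phi>_def) (auto simp: free_R1_simps intro!: restrict_ext)
    show "\<phi> (r \<odot>\<^bsub>free_R1 ?B\<^esub> f) = r \<odot>\<^bsub>free_R1 I\<^esub> \<phi> f"
      if "r \<in> carrier R1" "f \<in> carrier (free_R1 ?B)" for r f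
      using that B.smult_closed[OF that] by (simp add: \<phi>_def) (auto simp: free_R1_simps intro!: restrict_ext)
  qed
  ultimately show ?thesis
    unfolding free_module_def using module_free_R1 by blast
qed

section \<open>Free modules with a countable basis\<close>

text \<open>
  A copy of the natural numbers inside an arbitrary list type, since basis elements must be
  indexed by lists.
\<close>

definition idx :: "nat \<Rightarrow> 'b list" where
  "idx n = replicate n undefined"

lemma length_idx [simp]: "length (idx n) = n"
  by (simp add: idx_def)

lemma idx_eq_iff [simp]: "idx m = idx n \<longleftrightarrow> m = n"
  by (metis length_idx)

lemma idx_eq_Nil [simp]: "idx n = [] \<longleftrightarrow> n = 0"
  by (simp add: idx_def)

lemma tl_idx [simp]: "tl (idx n) = idx (n - 1)"
  by (cases n) (simp_all add: idx_def)

text \<open>Finite support turns into a bound on the index, so that sums over the support can be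
  taken over initial segments of the naturals.\<close>

lemma free_idx_vanishes:
  fixes f :: "'b list \<Rightarrow> (real \<Rightarrow>\<^sub>0 'k::field)"
  assumes "f \<in> carrier (free_R1 (range idx))"
  obtains N where "\<And>n. n \<ge> N \<Longrightarrow> f (idx n) = 0"
proof -
  have "idx ` {n. f (idx n) \<noteq> 0} \<subseteq> {i \<in> range idx. f i \<noteq> 0}"
    by auto
  moreover have "finite {i \<in> range idx. f i \<noteq> 0}"
    using assms by (simp add: free_R1_simps)
  ultimately have "finite ((idx :: nat \<Rightarrow> 'b list) ` {n. f (idx n) \<noteq> 0})"
    by (rule finite_subset)
  then have "finite {n. f (idx n) \<noteq> 0}"
    by (rule finite_imageD) (simp add: inj_on_def)
  then obtain N where "\<forall>n\<in>{n. f (idx n) \<noteq> 0}. n < N"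
    using finite_nat_set_iff_bounded by blast
  then show thesis
    by (intro that[of N]) (auto simp: not_less[symmetric])
qed

lemma free_idxI:
  fixes q :: "nat \<Rightarrow> (real \<Rightarrow>\<^sub>0 'k::field)"
  assumes "\<And>n. Poly_Mapping.keys (q n) \<subseteq> {0..}" and "\<And>n. n \<ge> N \<Longrightarrow> q n = 0"
  shows "(\<lambda>i\<in>range idx. q (length i)) \<in> carrier (free_R1 (range (idx :: nat \<Rightarrow> 'b list)))"
proof -
  have "{i \<in> range (idx :: nat \<Rightarrow> 'b list). q (length i) \<noteq> 0} \<subseteq> idx ` {..<N}"
    using assms(2) by (auto intro!: imageI) (meson not_le)
  then have "finite {i \<in> range (idx :: nat \<Rightarrow> 'b list). q (length i) \<noteq> 0}"
    by (rule finite_subset) simp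
  then show ?thesis
    using assms(1) by (simp add: free_R1_simps cong: conj_cong)
qed

lemma free_idx_eqI:
  assumes "f \<in> carrier (free_R1 (range idx))" "g \<in> carrier (free_R1 (range idx))"
    and "\<And>n. f (idx n) = g (idx n)"
  shows "f = g"
  using assms by (auto simp: free_R1_simps intro!: PiE_ext[of f "range idx" _ g])

text \<open>
  With basis \<open>y\<^sub>n\<close>, the maps of the resolution are \<open>y\<^sub>n \<mapsto> x\<^bsup>\<epsilon> n\<^esup>\<close> and
  \<open>y\<^sub>n \<mapsto> y\<^sub>n - x\<^bsup>\<epsilon> n - \<epsilon> (n+1)\<^esup> y\<^sub>n\<^sub>+\<^sub>1\<close>.
\<close>

definition generator_map ::
    "(nat \<Rightarrow> real) \<Rightarrow> ('b list \<Rightarrow> (real \<Rightarrow>\<^sub>0 'k::field)) \<Rightarrow> (real \<Rightarrow>\<^sub>0 'k)" where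
  "generator_map \<epsilon> f = (\<Sum>i\<in>{i \<in> range idx. f i \<noteq> 0}. f i * xpow (\<epsilon> (length i)))"

definition relation_map ::
    "(nat \<Rightarrow> real) \<Rightarrow> ('b list \<Rightarrow> (real \<Rightarrow>\<^sub>0 'k::field)) \<Rightarrow> 'b list \<Rightarrow> (real \<Rightarrow>\<^sub>0 'k)" where
  "relation_map \<epsilon> f = (\<lambda>i\<in>range idx. f i -
    (if i = [] then 0 else xpow (\<epsilon> (length i - 1) - \<epsilon> (length i)) * f (tl i)))"

text \<open>The relation of one generator also involves the next, so on coefficients each index
  receives a contribution from its predecessor; index 0 has none.\<close>

lemma relation_map_idx:
  "relation_map \<epsilon> f (idx 0) = f (idx 0)"
  "relation_map \<epsilon> f (idx (Suc n)) = f (idx (Suc n)) - xpow (\<epsilon> n - \<epsilon> (Suc n)) * f (idx n)"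
  by (simp_all add: relation_map_def)

lemma generator_map_eq_sum:
  assumes "\<And>n. n \<ge> N \<Longrightarrow> f (idx n) = 0"
  shows "generator_map \<epsilon> f = (\<Sum>n<N. f (idx n) * xpow (\<epsilon> n))"
proof -
  have "generator_map \<epsilon> f = (\<Sum>i\<in>idx ` {..<N}. f i * xpow (\<epsilon> (length i)))"
    unfolding generator_map_def using assms
    by (intro sum.mono_neutral_left) (auto intro!: imageI, meson not_le)
  also have "\<dots> = (\<Sum>n<N. f (idx n) * xpow (\<epsilon> n))"
    by (subst sum.reindex) (auto intro: inj_onI)
  finally show ?thesis .
qed

lemma generator_map_linear:
  fixes f g :: "'b list \<Rightarrow> (real \<Rightarrow>\<^sub>0 'k::field)"
  assumes "f \<in> carrier (free_R1 (range idx))"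
  shows "g \<in> carrier (free_R1 (range idx)) \<Longrightarrow>
      generator_map \<epsilon> (f \<oplus>\<^bsub>free_R1 (range idx)\<^esub> g) = generator_map \<epsilon> f + generator_map \<epsilon> g"
    and "Poly_Mapping.keys r \<subseteq> {0..} \<Longrightarrow>
      generator_map \<epsilon> (r \<odot>\<^bsub>free_R1 (range idx)\<^esub> f) = r * generator_map \<epsilon> f"
  unfolding generator_map_def using assms
  by (intro coordinate_extension_linear[where c = "\<lambda>f i. f i" and M = "free_R1 (range idx)"]
      module_free_R1; simp add: free_R1_simps)+

lemma generator_map_m1:
  fixes f :: "'b list \<Rightarrow> (real \<Rightarrow>\<^sub>0 'k::field)"
  assumes "\<And>k. \<epsilon> k > 0" "f \<in> carrier (free_R1 (range idx))"
  shows "generator_map \<epsilon> f \<in> m1"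
  unfolding m1_def generator_map_def
proof (intro CollectI keys_sum_subset)
  fix i assume "i \<in> {i \<in> range idx. f i \<noteq> 0}"
  then have "Poly_Mapping.keys (f i) \<subseteq> {0..}"
    using assms(2) by (auto simp: free_R1_simps PiE_iff)
  then have "Poly_Mapping.keys (f i * xpow (\<epsilon> (length i))) \<subseteq> {\<epsilon> (length i)..}"
    by (intro keys_mult_nonneg) auto
  then show "Poly_Mapping.keys (f i * xpow (\<epsilon> (length i))) \<subseteq> {0<..}"
    using assms(1)[of "length i"] by force
qed

text \<open>The finitely many exponents of \<open>p\<close> are positive, so some
  \<open>\<epsilon> N\<close> lies below them all. Then \<open>p\<close> is a multiple of this one
  generator, and a single nonzero coefficient suffices.\<close>

lemma generator_map_surj:
  fixes p :: "real \<Rightarrow>\<^sub>0 'k::field"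
  assumes lim: "\<epsilon> \<longlonglongrightarrow> 0" and p: "p \<in> m1"
  obtains f where "f \<in> carrier (free_R1 (range (idx :: nat \<Rightarrow> 'b list)))" "generator_map \<epsilon> f = p"
proof -
  have "\<forall>\<^sub>F k in sequentially. \<forall>a\<in>Poly_Mapping.keys p. \<epsilon> k < a"
    using p order_tendstoD(2)[OF lim] by (intro eventually_ball_finite) (auto simp: m1_def)
  then obtain N where "\<forall>a\<in>Poly_Mapping.keys p. \<epsilon> N < a"
    by (auto simp: eventually_sequentially)
  then have "Poly_Mapping.keys p \<subseteq> {\<epsilon> N..}"
    by force
  then obtain q where q: "Poly_Mapping.keys q \<subseteq> {0..}" "p = q * xpow (\<epsilon> N)"
    by (rule factor_xpow)
  define g where "g n = (if n = N then q else 0)" for n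
  let ?f = "\<lambda>i\<in>range (idx :: nat \<Rightarrow> 'b list). g (length i)"
  have "?f \<in> carrier (free_R1 (range idx))"
    by (rule free_idxI[of _ "Suc N"]) (auto simp: g_def q)
  moreover have "generator_map \<epsilon> ?f = (\<Sum>n<Suc N. ?f (idx n) * xpow (\<epsilon> n))"
    by (rule generator_map_eq_sum) (simp add: g_def)
  then have "generator_map \<epsilon> ?f = p"
    by (simp add: g_def q)
  ultimately show thesis
    by (rule that)
qed

lemma relation_map_carrier:
  fixes f :: "'b list \<Rightarrow> (real \<Rightarrow>\<^sub>0 'k::field)"
  assumes anti: "strict_antimono_on UNIV \<epsilon>" and f: "f \<in> carrier (free_R1 (range idx))"
  shows "relation_map \<epsilon> f \<in> carrier (free_R1 (range idx))"
proof -
  let ?q = "\<lambda>n. relation_map \<epsilon> f (idx n)"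
  have f_keys: "Poly_Mapping.keys (f (idx n)) \<subseteq> {0..}" for n
    using f by (auto simp: free_R1_simps PiE_iff)
  obtain N where N: "\<And>n. n \<ge> N \<Longrightarrow> f (idx n) = 0"
    using free_idx_vanishes[OF f] by blast
  have "(\<lambda>i\<in>range idx. ?q (length i)) \<in> carrier (free_R1 (range (idx :: nat \<Rightarrow> 'b list)))"
  proof (rule free_idxI)
    show "Poly_Mapping.keys (?q n) \<subseteq> {0..}" for n
    proof (cases n)
      case 0
      then show ?thesis
        using f_keys by (simp add: relation_map_idx)
    next
      case (Suc m)
      \<comment> \<open>As \<open>\<epsilon>\<close> decreases, the monomial in the relation has a
        nonnegative exponent and belongs to \<open>R1\<close>.\<close>
      have "\<epsilon> (Suc m) \<le> \<epsilon> m"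
        using anti by (simp add: monotone_on_def less_imp_le)
      then have "Poly_Mapping.keys (xpow (\<epsilon> m - \<epsilon> (Suc m)) * f (idx m)) \<subseteq> {0..}"
        by (intro keys_mult_nonneg f_keys) simp
      then show ?thesis
        using keys_add_subset[OF f_keys, of "- (xpow (\<epsilon> m - \<epsilon> (Suc m)) * f (idx m))" "Suc m"]
        by (simp add: relation_map_idx Suc)
    qed
    \<comment> \<open>The last nonzero coefficient of \<open>f\<close> spills over into the next
      index, hence \<open>Suc N\<close> instead of \<open>N\<close>.\<close>
    show "?q n = 0" if "n \<ge> Suc N" for n
      using that N by (cases n) (simp_all add: relation_map_idx)
  qed
  also have "(\<lambda>i\<in>range idx. ?q (length i)) = relation_map \<epsilon> f"
    by (auto simp: relation_map_def intro!: restrict_ext)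
  finally show ?thesis .
qed

text \<open>The sum telescopes: up to index \<open>M\<close> it leaves only the \<open>M\<close>-th
  coefficient times its monomial, and this is zero past the support.\<close>

lemma generator_relation_zero:
  fixes f :: "'b list \<Rightarrow> (real \<Rightarrow>\<^sub>0 'k::field)"
  assumes f: "f \<in> carrier (free_R1 (range idx))"
  shows "generator_map \<epsilon> (relation_map \<epsilon> f) = 0"
proof -
  obtain N where N: "\<And>n. n \<ge> N \<Longrightarrow> f (idx n) = 0"
    using free_idx_vanishes[OF f] by blast
  have telescope: "(\<Sum>n<Suc M. relation_map \<epsilon> f (idx n) * xpow (\<epsilon> n)) = f (idx M) * xpow (\<epsilon> M)" for M
  proof (induction M)
    case 0
    then show ?case
      by (simp add: relation_map_idx)
  next
    case (Suc M)
    have "xpow (\<epsilon> M - \<epsilon> (Suc M)) * f (idx M) * xpow (\<epsilon> (Suc M)) =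
        f (idx M) * (xpow (\<epsilon> M - \<epsilon> (Suc M)) * xpow (\<epsilon> (Suc M)))"
      by (simp add: mult_ac)
    also have "\<dots> = f (idx M) * xpow (\<epsilon> M)"
      by (simp add: xpow_mult)
    finally show ?case
      using Suc.IH by (auto simp: relation_map_idx left_diff_distrib)
  qed
  have "generator_map \<epsilon> (relation_map \<epsilon> f) = (\<Sum>n<Suc N. relation_map \<epsilon> f (idx n) * xpow (\<epsilon> n))"
  proof (rule generator_map_eq_sum)
    show "relation_map \<epsilon> f (idx n) = 0" if "n \<ge> Suc N" for n
      using that N by (cases n) (simp_all add: relation_map_idx)
  qed
  then show ?thesis
    unfolding telescope using N[of N] by simp
qed

text \<open>The equation determines the coefficients of \<open>f\<close> recursively. That
  \<open>g\<close> is killed by the generator map is what makes this solution finitely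
  supported.\<close>

lemma relation_map_exact:
  fixes g :: "'b list \<Rightarrow> (real \<Rightarrow>\<^sub>0 'k::field)"
  assumes anti: "strict_antimono_on UNIV \<epsilon>"
    and g: "g \<in> carrier (free_R1 (range idx))" "generator_map \<epsilon> g = 0"
  obtains f where "f \<in> carrier (free_R1 (range idx))" "relation_map \<epsilon> f = g"
proof -
  \<comment> \<open>Closed form of the recursion \<open>q (Suc n) = g (idx (Suc n)) + xpow
    (\<epsilon> n - \<epsilon> (Suc n)) * q n\<close>.\<close>
  define q where "q n = (\<Sum>j\<le>n. g (idx j) * xpow (\<epsilon> j - \<epsilon> n))" for n
  let ?f = "\<lambda>i\<in>range (idx :: nat \<Rightarrow> 'b list). q (length i)"
  obtain N where N: "\<And>n. n \<ge> N \<Longrightarrow> g (idx n) = 0"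
    using free_idx_vanishes[OF g(1)] by blast
  have f: "?f \<in> carrier (free_R1 (range idx))"
  proof (rule free_idxI)
    show "Poly_Mapping.keys (q n) \<subseteq> {0..}" for n
      unfolding q_def
    proof (intro keys_sum_subset keys_mult_nonneg)
      fix j assume "j \<in> {..n}"
      then have "\<epsilon> n \<le> \<epsilon> j"
        using anti by (cases "j = n") (auto simp: monotone_on_def less_imp_le)
      then show "Poly_Mapping.keys (xpow (\<epsilon> j - \<epsilon> n) :: real \<Rightarrow>\<^sub>0 'k) \<subseteq> {0..}"
        by simp
      show "Poly_Mapping.keys (g (idx j)) \<subseteq> {0..}"
        using g(1) by (auto simp: free_R1_simps PiE_iff)
    qed
    \<comment> \<open>Taking out \<open>xpow (- \<epsilon> n)\<close> leaves a partial sum of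
      \<open>generator_map \<epsilon> g\<close>, which is the whole sum once \<open>n\<close> is
      past the support.\<close>
    show "q n = 0" if n: "n \<ge> N" for n
    proof -
      have "q n = (\<Sum>j<Suc n. g (idx j) * xpow (\<epsilon> j)) * xpow (- \<epsilon> n)"
        unfolding q_def lessThan_Suc_atMost sum_distrib_right
        by (intro sum.cong) (auto simp: mult.assoc xpow_mult)
      also have "(\<Sum>j<Suc n. g (idx j) * xpow (\<epsilon> j)) = generator_map \<epsilon> g"
        using N n by (intro generator_map_eq_sum[symmetric]) simp
      finally show ?thesis
        using g(2) by simp
    qed
  qed
  moreover have "relation_map \<epsilon> ?f = g"
  proof (rule free_idx_eqI[OF relation_map_carrier[OF anti f] g(1)])
    show "relation_map \<epsilon> ?f (idx n) = g (idx n)" for n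
    proof (cases n)
      case 0
      then show ?thesis
        by (simp add: relation_map_idx q_def)
    next
      case (Suc m)
      have "xpow (\<epsilon> m - \<epsilon> (Suc m)) * q m = (\<Sum>j\<le>m. g (idx j) * xpow (\<epsilon> j - \<epsilon> (Suc m)))"
        unfolding q_def sum_distrib_left by (intro sum.cong) (auto simp: mult.left_commute xpow_mult)
      then have "q (Suc m) - xpow (\<epsilon> m - \<epsilon> (Suc m)) * q m = g (idx (Suc m))"
        by (simp add: q_def)
      then show ?thesis
        by (simp add: relation_map_idx Suc)
    qed
  qed
  ultimately show thesis
    by (rule that)
qed

text \<open>The map is triangular with ones on the diagonal, so the coefficients vanish one after
  another.\<close>

lemma relation_map_inj:
  assumes "\<And>n. relation_map \<epsilon> f (idx n) = 0"
  shows "f (idx n) = 0"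
proof (induction n)
  case 0
  then show ?case
    using assms[of 0] by (simp add: relation_map_idx)
next
  case (Suc n)
  then show ?case
    using assms[of "Suc n"] by (simp add: relation_map_idx)
qed

section \<open>Assembling the resolution\<close>

text \<open>All terms of a resolution share one type, so the ring in degree 0 is encoded as the
  functions on \<open>{[]}\<close>; hence the constant function around the value.\<close>

lemma linear_map_generator:
  fixes \<epsilon> :: "nat \<Rightarrow> real"
  assumes pos: "\<And>k. \<epsilon> k > 0"
  shows "(\<lambda>f\<in>carrier (free_R1 (range idx)). \<lambda>i\<in>{[]}. generator_map \<epsilon> f)
    \<in> linear_maps R1 (free_R1 (range (idx :: nat \<Rightarrow> 'b list)))
        (free_R1 {[] :: 'b list} :: (real \<Rightarrow>\<^sub>0 'k::field, _) module)"
proof -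
  let ?M = "free_R1 (range (idx :: nat \<Rightarrow> 'b list)) :: (real \<Rightarrow>\<^sub>0 'k, _) module"
  interpret M: module R1 ?M by (rule module_free_R1)
  have closed: "(\<lambda>i\<in>{[]}. generator_map \<epsilon> f) \<in> carrier (free_R1 {[] :: 'b list})"
    if "f \<in> carrier ?M" for f
  proof -
    have "Poly_Mapping.keys (generator_map \<epsilon> f) \<subseteq> {0..}"
      using generator_map_m1[of \<epsilon>, OF pos that] by (auto simp: m1_def)
    then show ?thesis
      by (simp add: free_R1_simps)
  qed
  show ?thesis
    unfolding linear_maps_def
  proof (intro CollectI conjI ballI)
    show "(\<lambda>f\<in>carrier ?M. \<lambda>i\<in>{[]}. generator_map \<epsilon> f) \<in> carrier ?M \<rightarrow>\<^sub>E carrier (free_R1 {[] :: 'b list})"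
      using closed by (simp add: Pi_iff)
  qed (simp_all add: M.a_closed M.smult_closed generator_map_linear,
       auto simp: free_R1_simps intro!: restrict_ext)
qed

lemma linear_map_relation:
  fixes \<epsilon> :: "nat \<Rightarrow> real"
  assumes anti: "strict_antimono_on UNIV \<epsilon>"
  shows "(\<lambda>f\<in>carrier (free_R1 (range idx)). relation_map \<epsilon> f)
    \<in> linear_maps R1 (free_R1 (range (idx :: nat \<Rightarrow> 'b list)))
        (free_R1 (range (idx :: nat \<Rightarrow> 'b list)) :: (real \<Rightarrow>\<^sub>0 'k::field, _) module)"
proof -
  let ?M = "free_R1 (range (idx :: nat \<Rightarrow> 'b list)) :: (real \<Rightarrow>\<^sub>0 'k, _) module"
  interpret M: module R1 ?M by (rule module_free_R1)
  have tl: "tl i \<in> range idx" if "i \<in> range (idx :: nat \<Rightarrow> 'b list)" for i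
    using that by auto
  have add: "relation_map \<epsilon> (f \<oplus>\<^bsub>?M\<^esub> g) = relation_map \<epsilon> f \<oplus>\<^bsub>?M\<^esub> relation_map \<epsilon> g" for f g
    using tl by (auto simp: relation_map_def free_R1_simps algebra_simps intro!: restrict_ext)
  have smult: "relation_map \<epsilon> (r \<odot>\<^bsub>?M\<^esub> f) = r \<odot>\<^bsub>?M\<^esub> relation_map \<epsilon> f" for r f
    using tl by (auto simp: relation_map_def free_R1_simps algebra_simps intro!: restrict_ext)
  show ?thesis
    unfolding linear_maps_def
  proof (intro CollectI conjI ballI)
    show "(\<lambda>f\<in>carrier ?M. relation_map \<epsilon> f) \<in> carrier ?M \<rightarrow>\<^sub>E carrier ?M"
      by (simp add: Pi_iff relation_map_carrier[OF anti])
  qed (simp_all add: M.a_closed M.smult_closed add smult)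
qed

lemma linear_map_residue_class:
  "(\<lambda>f\<in>carrier (free_R1 {i}). residue_class (const_coeff (f i)))
    \<in> linear_maps R1 (free_R1 {i}) (residue_field :: (real \<Rightarrow>\<^sub>0 'k::field, _) module)"
proof -
  let ?M = "free_R1 {i} :: (real \<Rightarrow>\<^sub>0 'k, _) module"
  interpret M: module R1 ?M by (rule module_free_R1)
  show ?thesis
    unfolding linear_maps_def
  proof (intro CollectI conjI ballI)
    show "(\<lambda>f\<in>carrier ?M. residue_class (const_coeff (f i))) \<in> carrier ?M \<rightarrow>\<^sub>E carrier residue_field"
      by (simp add: carrier_residue_field Pi_iff)
  qed (simp_all add: M.a_closed M.smult_closed,
       simp_all add: free_R1_simps residue_field_add residue_field_smult lookup_add PiE_iff const_coeff_mult)
qed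

lemma carrier_free_R1_empty: "carrier (free_R1 {}) = {\<zero>\<^bsub>free_R1 {}\<^esub>}"
  by (simp add: free_R1_simps restrict_def)

text \<open>Exactness in degree 0 holds because the monomials \<open>xpow (\<epsilon> n)\<close>
  generate \<open>m1\<close>, in degree 1 because consecutive relations generate all others, and in
  degree 2 because the relation map is injective.\<close>

lemma residue_field_resolution:
  fixes \<epsilon> :: "nat \<Rightarrow> real"
  assumes pos: "\<And>k. \<epsilon> k > 0" and anti: "strict_antimono_on UNIV \<epsilon>" and lim: "\<epsilon> \<longlonglongrightarrow> 0"
  shows "has_free_resolution_of_length R1
    (residue_field :: (real \<Rightarrow>\<^sub>0 'k::field, (real \<Rightarrow>\<^sub>0 'k) set) module) 2"
proof -
  note One_nat_def [simp del]
  let ?M = "free_R1 (range idx) :: (real \<Rightarrow>\<^sub>0 'k, (real \<Rightarrow>\<^sub>0 'k) set) res_term"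
  let ?R = "free_R1 {[]} :: (real \<Rightarrow>\<^sub>0 'k, (real \<Rightarrow>\<^sub>0 'k) set) res_term"
  let ?E = "free_R1 {} :: (real \<Rightarrow>\<^sub>0 'k, (real \<Rightarrow>\<^sub>0 'k) set) res_term"
  \<comment> \<open>Rank one in degree 0, countable rank in degrees 1 and 2, and the free module on
    the empty basis, which is zero, from degree 3 on.\<close>
  define P :: "nat \<Rightarrow> (real \<Rightarrow>\<^sub>0 'k, (real \<Rightarrow>\<^sub>0 'k) set) res_term" where
    "P n = (if n = 0 then ?R else if n \<le> 2 then ?M else ?E)" for n
  define d where "d n =
    (if n = 0 then (\<lambda>f\<in>carrier ?M. \<lambda>i\<in>{[]}. generator_map \<epsilon> f)
     else if n = 1 then (\<lambda>f\<in>carrier ?M. relation_map \<epsilon> f)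
     else (\<lambda>f\<in>carrier (P (Suc n)). \<zero>\<^bsub>P n\<^esub>))" for n
  define e :: "_ \<Rightarrow> (real \<Rightarrow>\<^sub>0 'k) set" where
    "e = (\<lambda>f\<in>carrier ?R. residue_class (const_coeff (f [])))"
  have P: "P 0 = ?R" "P 1 = ?M" "P (Suc 0) = ?M" "P 2 = ?M" "P (Suc 1) = ?M" "P (Suc (Suc 0)) = ?M"
    "\<And>n. P (Suc (Suc (Suc n))) = ?E"
    "\<And>n. n > 2 \<Longrightarrow> P n = ?E"
    by (simp_all add: P_def)
  have module_P: "module R1 (P n)" for n
    by (simp add: P_def module_free_R1)
  have R_eqI: "f = g" if "f \<in> carrier ?R" "g \<in> carrier ?R" "f [] = g []" for f g
    using that by (intro PiE_ext[of f "{[]}" "\<lambda>_. {p. Poly_Mapping.keys p \<subseteq> {0..}}" g])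
      (simp_all add: free_R1_simps)
  have "free_resolution R1 residue_field P d e"
    unfolding free_resolution_def
  proof (intro conjI allI)
    show "free_module R1 (P n)" for n
      by (simp add: P_def free_module_free_R1)
    show "d n \<in> linear_maps R1 (P (Suc n)) (P n)" for n
    proof -
      consider "n = 0" | "n = 1" | "n > 1"
        by linarith
      then show ?thesis
      proof cases
        case 1
        then show ?thesis
          using linear_map_generator[of \<epsilon>, OF pos] by (simp add: d_def P)
      next
        case 2
        then show ?thesis
          using linear_map_relation[OF anti] by (simp add: d_def P)
      next
        case 3
        then show ?thesis
          using zero_linear[OF module_P[of "Suc n"] module_P[of n]] by (simp add: d_def)
      qed
    qed
    show "e \<in> linear_maps R1 (P 0) residue_field"
      unfolding e_def P by (rule linear_map_residue_class)
    show "e ` carrier (P 0) = carrier residue_field"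
    proof -
      have "residue_class c \<in> e ` carrier ?R" for c
      proof (rule image_eqI)
        let ?f = "\<lambda>i\<in>{[]}. Poly_Mapping.single 0 c"
        show f: "?f \<in> carrier ?R"
          by (simp add: free_R1_simps)
        show "residue_class c = e ?f"
          unfolding e_def restrict_apply'[OF f] by simp
      qed
      moreover have "e f \<in> range residue_class" if "f \<in> carrier ?R" for f
        using that by (simp add: e_def)
      ultimately show ?thesis
        unfolding P carrier_residue_field by blast
    qed
    show "a_kernel (P 0) residue_field e = d 0 ` carrier (P 1)"
      unfolding P
    proof (intro equalityI subsetI)
      fix f assume "f \<in> a_kernel ?R residue_field e"
      then have f: "f \<in> carrier ?R" and "const_coeff (f []) = 0"
        by (auto simp: a_kernel_def' e_def residue_field_zero residue_class_inj)
      moreover have "Poly_Mapping.keys (f []) \<subseteq> {0..}"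
        using f by (auto simp: free_R1_simps PiE_iff)
      ultimately have "f [] \<in> m1"
        unfolding residue_class_zero[symmetric] by (simp add: residue_class_def)
      then obtain g where g: "g \<in> carrier ?M" "generator_map \<epsilon> g = f []"
        using generator_map_surj[OF lim] by blast
      have "d 0 g \<in> carrier ?R"
        using linear_maps_closed[OF linear_map_generator[of \<epsilon>, OF pos] g(1)] by (simp add: d_def)
      then have "f = d 0 g"
        using f g by (intro R_eqI) (simp_all add: d_def)
      then show "f \<in> d 0 ` carrier ?M"
        using g by blast
    next
      fix f assume "f \<in> d 0 ` carrier ?M"
      then obtain g where g: "g \<in> carrier ?M" "f = d 0 g"
        by blast
      have "f \<in> carrier ?R"
        unfolding g(2) using linear_maps_closed[OF linear_map_generator[of \<epsilon>, OF pos] g(1)]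
        by (simp add: d_def)
      moreover have "const_coeff (f []) = 0"
        unfolding g(2) using generator_map_m1[of \<epsilon>, OF pos g(1)] g(1)
        by (simp add: d_def residue_class_zero[symmetric]) (simp add: residue_class_def)
      ultimately show "f \<in> a_kernel ?R residue_field e"
        by (simp add: a_kernel_def' e_def residue_field_zero)
    qed
    show "a_kernel (P (Suc n)) (P n) (d n) = d (Suc n) ` carrier (P (Suc (Suc n)))" for n
    proof -
      consider "n = 0" | "n = 1" | m where "n = Suc (Suc m)"
        by (metis One_nat_def not0_implies_Suc)
      then show ?thesis
      proof cases
        case 1
        have "a_kernel ?M ?R (d 0) = d 1 ` carrier ?M"
        proof (intro equalityI subsetI)
          fix g assume "g \<in> a_kernel ?M ?R (d 0)"
          then have g: "g \<in> carrier ?M" and "d 0 g [] = \<zero>\<^bsub>?R\<^esub> []"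
            by (auto simp: a_kernel_def')
          then have "generator_map \<epsilon> g = 0"
            by (simp add: d_def free_R1_simps(2))
          then obtain f where "f \<in> carrier ?M" "relation_map \<epsilon> f = g"
            using relation_map_exact[OF anti g] by blast
          then show "g \<in> d 1 ` carrier ?M"
            by (intro image_eqI[of _ _ f]) (simp_all add: d_def)
        next
          fix g assume "g \<in> d 1 ` carrier ?M"
          then obtain f where f: "f \<in> carrier ?M" "g = relation_map \<epsilon> f"
            by (auto simp: d_def)
          then have "g \<in> carrier ?M" "generator_map \<epsilon> g = 0"
            using relation_map_carrier[OF anti] generator_relation_zero by auto
          then show "g \<in> a_kernel ?M ?R (d 0)"
            by (simp add: a_kernel_def' d_def free_R1_simps(2))
        qed
        then show ?thesis
          using 1 by (simp add: P One_nat_def)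
      next
        case 2
        \<comment> \<open>Injectivity of the relation map: its kernel has to match the image of the
          zero module in degree 3.\<close>
        have "f = \<zero>\<^bsub>?M\<^esub>" if f: "f \<in> carrier ?M" "relation_map \<epsilon> f = \<zero>\<^bsub>?M\<^esub>" for f
        proof (rule free_idx_eqI[OF f(1)])
          show "\<zero>\<^bsub>?M\<^esub> \<in> carrier ?M"
            by (simp add: free_R1_simps)
          show "f (idx n) = \<zero>\<^bsub>?M\<^esub> (idx n)" for n
            using relation_map_inj[of \<epsilon> f n] f(2) by (simp add: free_R1_simps(2))
        qed
        moreover have "relation_map \<epsilon> \<zero>\<^bsub>?M\<^esub> = \<zero>\<^bsub>?M\<^esub>" "\<zero>\<^bsub>?M\<^esub> \<in> carrier ?M"
          by (auto simp: relation_map_def free_R1_simps intro!: restrict_ext)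
        ultimately have "a_kernel ?M ?M (d 1) = {\<zero>\<^bsub>?M\<^esub>}"
          by (auto simp: a_kernel_def' d_def)
        moreover have "d 2 ` carrier ?E = {\<zero>\<^bsub>?M\<^esub>}"
          unfolding carrier_free_R1_empty by (simp add: d_def P carrier_free_R1_empty)
        ultimately show ?thesis
          using 2 by (simp add: P numeral_2_eq_2)
      next
        case (3 m)
        then show ?thesis
          by (simp add: P a_kernel_def' d_def carrier_free_R1_empty)
      qed
    qed
  qed
  \<comment> \<open>Length two requires the last term to be nonzero; the unit vector at
    \<open>idx 0\<close> witnesses this.\<close>
  moreover have "carrier (P 2) \<noteq> {\<zero>\<^bsub>P 2\<^esub>}"
  proof -
    let ?f = "\<lambda>i\<in>range (idx :: nat \<Rightarrow> ((real \<Rightarrow>\<^sub>0 'k) + (real \<Rightarrow>\<^sub>0 'k) set) list).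
      if length i = 0 then 1 else 0 :: real \<Rightarrow>\<^sub>0 'k"
    have "?f \<in> carrier ?M"
      by (rule free_idxI[of _ 1]) auto
    moreover have "?f (idx 0) \<noteq> \<zero>\<^bsub>?M\<^esub> (idx 0)"
      by (simp add: free_R1_simps(2))
    ultimately show ?thesis
      unfolding P by (metis singletonD)
  qed
  moreover have "carrier (P n) = {\<zero>\<^bsub>P n\<^esub>}" if "n > 2" for n
    unfolding P(8)[OF that] by (rule carrier_free_R1_empty)
  ultimately show ?thesis
    unfolding has_free_resolution_of_length_def by blast
qed

theorem lemma3p2:
  fixes \<epsilon> :: "nat \<Rightarrow> real"
  assumes "\<And>k. \<epsilon> k > 0"
    and "strict_antimono_on UNIV \<epsilon>"
    and "\<epsilon> \<longlonglongrightarrow> 0"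
  shows "has_free_resolution_of_length R1
      (residue_field :: (real \<Rightarrow>\<^sub>0 'k::field, (real \<Rightarrow>\<^sub>0 'k) set) module) 2 \<and>
    carrier (Ext R1 2 (residue_field :: (real \<Rightarrow>\<^sub>0 'k, (real \<Rightarrow>\<^sub>0 'k) set) module) (F_module \<epsilon>))
      \<noteq> {\<zero>\<^bsub>Ext R1 2 (residue_field :: (real \<Rightarrow>\<^sub>0 'k, (real \<Rightarrow>\<^sub>0 'k) set) module) (F_module \<epsilon>)\<^esub>}"
proof
  let ?K = "residue_field :: (real \<Rightarrow>\<^sub>0 'k, (real \<Rightarrow>\<^sub>0 'k) set) module"
  show length: "has_free_resolution_of_length R1 ?K 2"
    using assms by (rule residue_field_resolution)
  let ?Q = "\<lambda>(P :: nat \<Rightarrow> (real \<Rightarrow>\<^sub>0 'k, (real \<Rightarrow>\<^sub>0 'k) set) res_term, d).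
    \<exists>e. free_resolution R1 ?K P d e"
  obtain P d where Pd: "(SOME z. ?Q z) = (P, d)"
    by (cases "SOME z. ?Q z")
  \<comment> \<open>The explicit resolution lives in the type over which \<open>Ext\<close> chooses,
    so the chosen pair is a free resolution as well. Only this property of the choice is used
    afterwards.\<close>
  have "\<exists>z. ?Q z"
    using length unfolding has_free_resolution_of_length_def by auto
  then have "?Q (SOME z. ?Q z)"
    by (rule someI_ex)
  then obtain e where res: "free_resolution R1 ?K P d e"
    unfolding Pd by auto
  then have "module R1 (P n)" "d n \<in> linear_maps R1 (P (Suc n)) (P n)" for n
    by (auto simp: free_resolution_def free_module_def)
  moreover obtain u where "u \<in> cocycles R1 P d (F_module \<epsilon>) 2"
    "u \<notin> coboundaries R1 P d (F_module \<epsilon>) 2"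
    using obstruction_cocycle[OF res assms] by blast
  moreover have "module R1 (F_module \<epsilon> :: (real \<Rightarrow>\<^sub>0 'k, _) module)"
    using assms(1) by (intro module_F_module less_imp_le)
  ultimately have "carrier (Hom_cohomology R1 P d (F_module \<epsilon>) 2)
      \<noteq> {\<zero>\<^bsub>Hom_cohomology R1 P d (F_module \<epsilon>) 2\<^esub>}"
    by (intro Hom_cohomology_nonzero) auto
  then show "carrier (Ext R1 2 ?K (F_module \<epsilon>)) \<noteq> {\<zero>\<^bsub>Ext R1 2 ?K (F_module \<epsilon>)\<^esub>}"
    unfolding Ext_def Pd by simp
qed

end
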